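(* Let $n \geq 3$ and let $a_{1}, a_{2}, \ldots, a_{n}$ be distinct nonzero square-free integers, none of which is $1$. Then the polynomial $f(x) = (x^{2} - a_{1})(x^{2} - a_{2}) \cdots (x^{2} - a_{n})$ has roots modulo every positive integer if and only if the following two conditions are satisfied: (1) There exists a set $T \subseteq \{1, 2, \ldots, n\}$ of odd cardinality such that: (a) the product $\prod_{j \in T} a_{j}$ is a perfect square; and (b) for every $j \in T$ and for every odd prime $p$ dividing $a_{j}$, there exists $i \in \{1, \ldots, n\}$, $i \neq j$, such that $\left(\frac{a_{i}}{p}\right) = +1$. (2) One of the $a_{i}$ is of the form $8m + 1$ for some $m \in \mathbb{Z}$ with $m \neq 0$.
   Context: A polynomial $f \in \mathbb{Z}[x]$ has roots modulo every positive integer if for every positive integer $m$ the congruence $f(x) \equiv 0 \pmod{m}$ is solvable in integers $x$. For an odd prime $p$ and an integer $a$, $\left(\frac{a}{p}\right)$ is the Legendre symbol: it is $0$ if $p \mid a$; if $p \nmid a$, it is $+1$ if $a$ is a square modulo $p$ and $-1$ otherwise. Square-free integers may be negative; an integer is square-free if it is not divisible by the square of any prime. *)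

theory Defs
  imports "HOL-Number_Theory.Number_Theory"
    "HOL-Computational_Algebra.Polynomial"
    "HOL-Computational_Algebra.Squarefree"
    "HOL-Computational_Algebra.Nth_Powers"
begin

definition has_roots_modulo_every_pos_int :: "int poly \<Rightarrow> bool" where
  "has_roots_modulo_every_pos_int f \<longleftrightarrow> (\<forall>m::int. m > 0 \<longrightarrow> (\<exists>x::int. [poly f x = 0] (mod m)))"

end

theory Submission
  imports Defs "HOL-Analysis.Analysis"
begin

text \<open>
The only deep point is condition (1a). Write \<open>a\<^sub>S\<close> for the product of the \<open>a\<^sub>j\<close> with
\<open>j \<in> S\<close>, and suppose that no \<open>a\<^sub>S\<close> with \<open>card S\<close> odd is a square, while every prime \<open>p\<close>
not dividing \<open>M = 2 a\<^sub>1 \<cdots> a\<^sub>n\<close> has some \<open>i\<close> with \<open>a\<^sub>i\<close> a quadratic residue modulo \<open>p\<close>.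
Toggling \<open>i\<close> is a bijection between the even and the odd subsets \<open>S\<close> that preserves the symbol
of \<open>a\<^sub>S\<close> at \<open>p\<close>. Comparing Euler products therefore gives, for \<open>s > 1\<close>, that the product of
\<open>L(s, a\<^sub>S)\<close> over all even \<open>S\<close> equals the product over all odd \<open>S\<close>, where \<open>L(s, D)\<close> is the Dirichlet series of
the Jacobi symbol of \<open>D\<close> on the integers prime to \<open>M\<close>. As \<open>s\<close> decreases to 1, the right-hand
side stays bounded, since by quadratic reciprocity the symbol of a nonsquare is periodic with bounded
partial sums. On the left, the factor of the empty set tends to infinity and every other factor stays
away from 0, because \<open>L(s, D) \<ge> 1\<close> for square \<open>D\<close> and \<open>L(1, D) \<noteq> 0\<close> for nonsquare \<open>D\<close>. This is a contradiction. All other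
implications follow from Hensel lifting and the Chinese remainder theorem.
\<close>

section \<open>Legendre and Jacobi symbols\<close>

lemma Legendre_cong:
  assumes "[a = b] (mod p)"
  shows "Legendre a p = Legendre b p"
proof -
  have "[x = a] (mod p) \<longleftrightarrow> [x = b] (mod p)" for x
    using cong_trans[OF _ assms] cong_trans[OF _ cong_sym[OF assms]] by blast
  hence "QuadRes p a \<longleftrightarrow> QuadRes p b" by (simp add: QuadRes_def)
  moreover have "[a = 0] (mod p) \<longleftrightarrow> [b = 0] (mod p)"
    using cong_trans[OF assms] cong_trans[OF cong_sym[OF assms]] by blast
  ultimately show ?thesis by (simp add: Legendre_def)
qed

lemma Legendre_values: "Legendre a p \<in> {-1, 0, 1}"
  by (auto simp: Legendre_def)

text \<open>Two elements of {-1, 0, 1} differ by at most 2, so a modulus above 2 separates them.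
  This turns the congruence of Euler's criterion into an equality.\<close>

lemma Legendre_unique:
  fixes p :: nat
  assumes "2 < p" "[Legendre a p = b] (mod p)" "b \<in> {-1, 0, 1}"
  shows "Legendre a p = b"
proof -
  have "Legendre a p \<in> {-1, 0, 1}" by (rule Legendre_values)
  hence *: "\<bar>Legendre a p - b\<bar> \<le> 2" using assms(3) by auto
  have "int p dvd (Legendre a p - b)" using assms(2) by (simp add: cong_iff_dvd_diff)
  hence "Legendre a p - b = 0"
    using * assms(1) dvd_imp_le_int[of "Legendre a p - b" "int p"] by fastforce
  thus ?thesis by simp
qed

lemma Legendre_mult:
  fixes p :: nat
  assumes "prime p" "2 < p"
  shows "Legendre (a * b) p = Legendre a p * Legendre b p"
proof (rule Legendre_unique)
  have "[Legendre (a * b) p = (a * b) ^ ((p - 1) div 2)] (mod p)"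
    by (rule euler_criterion[OF assms])
  also have "(a * b) ^ ((p - 1) div 2) = a ^ ((p - 1) div 2) * b ^ ((p - 1) div 2)"
    by (rule power_mult_distrib)
  also have "[a ^ ((p - 1) div 2) * b ^ ((p - 1) div 2) = Legendre a p * Legendre b p] (mod p)"
    using euler_criterion[OF assms] by (intro cong_mult) (auto simp: cong_sym)
  finally show "[Legendre (a * b) p = Legendre a p * Legendre b p] (mod p)" .
  show "Legendre a p * Legendre b p \<in> {-1, 0, 1}"
    using Legendre_values[of a p] Legendre_values[of b p] by auto
qed (use assms in auto)

section \<open>The characters modulo 4 and 8 and the supplementary laws\<close>

definition sgn4 :: "nat \<Rightarrow> int" where
  "sgn4 n = (if n mod 4 = 1 then 1 else -1)"

text \<open>On odd \<open>n\<close> this is the quadratic character attached to 2. Even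
  \<open>n\<close> receive the default -1, so multiplicativity holds between odd arguments
  only.\<close>

definition sgn8 :: "nat \<Rightarrow> int" where
  "sgn8 n = (if n mod 8 = 1 \<or> n mod 8 = 7 then 1 else -1)"

lemma odd_mod_4: "odd (n::nat) \<Longrightarrow> n mod 4 = 1 \<or> n mod 4 = 3"
  by presburger

lemma odd_mod_8: "odd (n::nat) \<Longrightarrow> n mod 8 = 1 \<or> n mod 8 = 3 \<or> n mod 8 = 5 \<or> n mod 8 = 7"
  by presburger

lemma sgn4_mult:
  assumes "odd m" "odd n"
  shows "sgn4 (m * n) = sgn4 m * sgn4 n"
  using odd_mod_4[OF assms(1)] odd_mod_4[OF assms(2)]
  unfolding sgn4_def mod_mult_eq[of m 4 n, symmetric]
  by (elim disjE) simp_all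

lemma sgn8_mult:
  assumes "odd m" "odd n"
  shows "sgn8 (m * n) = sgn8 m * sgn8 n"
  using odd_mod_8[OF assms(1)] odd_mod_8[OF assms(2)]
  unfolding sgn8_def mod_mult_eq[of m 8 n, symmetric]
  by (elim disjE) simp_all

lemma minus_one_power_eq_sgn4: "odd n \<Longrightarrow> (-1::int) ^ ((n - 1) div 2) = sgn4 n"
proof -
  assume "odd n"
  hence "even ((n - 1) div 2) \<longleftrightarrow> n mod 4 = 1" by presburger
  thus ?thesis by (auto simp: sgn4_def)
qed

lemma Legendre_minus_one:
  fixes p :: nat
  assumes "prime p" "2 < p"
  shows "Legendre (-1) p = sgn4 p"
proof (rule Legendre_unique)
  have "odd p" using assms by (simp add: prime_odd_nat)
  thus "[Legendre (-1) p = sgn4 p] (mod p)"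
    using euler_criterion[OF assms, of "-1"] minus_one_power_eq_sgn4 by metis
qed (use assms in \<open>auto simp: sgn4_def\<close>)

text \<open>Gauss's lemma with multiplier 2: the symbol is the parity of the number of doubles
  \<open>2 * x\<close> with \<open>x \<le> h\<close> that exceed
  \<open>h = (p - 1) / 2\<close>.\<close>

lemma Legendre_two:
  fixes p :: nat
  assumes "prime p" "2 < p"
  shows "Legendre 2 p = sgn8 p"
proof -
  have "odd p" using assms by (simp add: prime_odd_nat)
  have "[(2::int) \<noteq> 0] (mod p)"
    using assms by (auto simp: cong_0_iff dest: zdvd_imp_le)
  hence G: "GAUSS p 2"
    by (rule GAUSS.intro[OF assms]) simp
  note defs = GAUSS.A_def[OF G] GAUSS.B_def[OF G] GAUSS.C_def[OF G] GAUSS.E_def[OF G]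
  define A E where "A = GAUSS.A p" and "E = GAUSS.E p 2"
  define h where "h = (int p - 1) div 2"
  have hp: "int p = 2 * h + 1" using \<open>odd p\<close> unfolding h_def by presburger
  have h0: "h > 0" using hp assms(2) by linarith
  \<comment> \<open>Since \<open>2 * x \<le> 2 * h < p\<close>, doubling needs no reduction modulo
    \<open>p\<close>, and exceeding \<open>h\<close> means \<open>x > h div 2\<close>.\<close>
  have "E = (\<lambda>x. 2 * x) ` {h div 2 <.. h}"
  proof (intro equalityI subsetI)
    fix y assume "y \<in> E"
    then obtain x where x: "0 < x" "x \<le> h" "y = (x * 2) mod p" "y > h"
      unfolding E_def defs h_def by auto
    have "y = x * 2" using x(1,2,3) hp by (simp add: mod_pos_pos_trivial)
    thus "y \<in> (\<lambda>x. 2 * x) ` {h div 2 <.. h}" using x by (intro image_eqI[of _ _ x]) auto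
  next
    fix y assume "y \<in> (\<lambda>x. 2 * x) ` {h div 2 <.. h}"
    then obtain x where x: "y = 2 * x" "h div 2 < x" "x \<le> h" by auto
    have "x > 0" using x(2) h0 by linarith
    have "y = (x * 2) mod p" using x \<open>x > 0\<close> hp by (simp add: mod_pos_pos_trivial)
    moreover have "y > h" using x by linarith
    moreover have "x \<in> A" using x(3) \<open>x > 0\<close> by (auto simp: A_def defs h_def)
    ultimately show "y \<in> E" unfolding A_def E_def defs(2-4) h_def by blast
  qed
  hence "card E = card {h div 2 <.. h}"
    by (simp add: card_image inj_on_def)
  also have "\<dots> = nat (h - h div 2)" by simp
  finally have cE: "int (card E) = h - h div 2" using h0 by simp
  have "even (h - h div 2) \<longleftrightarrow> p mod 8 = 1 \<or> p mod 8 = 7"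
  proof -
    have "int p mod 8 = int (p mod 8)" by (simp add: zmod_int)
    moreover have "even (h - h div 2) \<longleftrightarrow> int p mod 8 = 1 \<or> int p mod 8 = 7"
    proof -
      \<comment> \<open>The parity of \<open>h - h div 2\<close> depends on \<open>h\<close> modulo
        4, that is, on \<open>p = 2 * h + 1\<close> modulo 8.\<close>
      obtain j t where h: "h = 4 * j + t" "t \<in> {0, 1, 2, 3}"
        using mult_div_mod_eq[of 4 h, symmetric] by (rule that) (simp; presburger)
      have "int p = 2 * t + 1 + 8 * j" using hp h(1) by simp
      hence "int p mod 8 = (2 * t + 1) mod 8" by simp
      moreover have "h div 2 = 2 * j + t div 2" using h(1) by simp
      hence "h - h div 2 = 2 * j + (t - t div 2)" using h(1) by simp
      ultimately show ?thesis using h(2) by auto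
    qed
    ultimately show ?thesis by linarith
  qed
  hence "even (card E) \<longleftrightarrow> p mod 8 = 1 \<or> p mod 8 = 7"
    using cE by (metis even_of_nat)
  thus ?thesis using GAUSS.gauss_lemma[OF G] by (auto simp: sgn8_def E_def)
qed

text \<open>Reciprocity solved for one symbol: the other is nonzero, hence its own inverse. The sign
  is written through \<open>sgn4 q\<close> so that its dependence on \<open>q\<close> is visibly
  multiplicative.\<close>

lemma Legendre_reciprocity:
  fixes p q :: nat
  assumes "prime p" "2 < p" "prime q" "2 < q" "p \<noteq> q"
  shows "Legendre p q = Legendre q p * (if p mod 4 = 1 then 1 else sgn4 q)"
proof -
  have odd: "odd p" "odd q" using assms by (simp_all add: prime_odd_nat)
  have "Legendre p q * Legendre q p = (-1::int) ^ ((p - 1) div 2 * ((q - 1) div 2))"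
    by (rule Quadratic_Reciprocity[OF assms])
  also have "\<dots> = (sgn4 q) ^ ((p - 1) div 2)"
    unfolding minus_one_power_eq_sgn4[OF odd(2), symmetric] power_mult[symmetric]
    by (simp only: mult.commute)
  also have "\<dots> = (if p mod 4 = 1 then 1 else sgn4 q)"
  proof -
    have "even ((p - 1) div 2) \<longleftrightarrow> p mod 4 = 1" using odd(1) by presburger
    thus ?thesis by (auto simp: sgn4_def)
  qed
  finally have *: "Legendre p q * Legendre q p = (if p mod 4 = 1 then 1 else sgn4 q)" .
  have "Legendre q p \<noteq> 0" using * by (auto simp: sgn4_def split: if_splits)
  hence "Legendre q p * Legendre q p = 1"
    using Legendre_values[of q p] by auto
  hence "Legendre p q = (Legendre p q * Legendre q p) * Legendre q p"
    by (simp add: mult.assoc)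
  thus ?thesis unfolding * by (simp only: mult.commute)
qed

text \<open>The prime factors are taken with multiplicity. At even \<open>n\<close> this is not the
  Kronecker symbol, so the laws below concern odd \<open>n\<close>.\<close>

definition Jacobi :: "int \<Rightarrow> nat \<Rightarrow> int" where
  "Jacobi D n = (\<Prod>p\<in>#prime_factorization n. Legendre D (int p))"

lemma Jacobi_1 [simp]: "Jacobi D (Suc 0) = 1"
  by (simp add: Jacobi_def)

lemma Jacobi_prime: "prime p \<Longrightarrow> Jacobi D p = Legendre D p"
  by (simp add: Jacobi_def prime_factorization_prime)

lemma Jacobi_mult_right:
  "m > 0 \<Longrightarrow> n > 0 \<Longrightarrow> Jacobi D (m * n) = Jacobi D m * Jacobi D n"
  by (simp add: Jacobi_def prime_factorization_mult)

lemma odd_prime_factor_gt_2: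
  assumes "odd (n::nat)" "p \<in> prime_factors n"
  shows "prime p" "2 < p"
proof -
  show "prime p" using assms(2) by auto
  have "p dvd n" using assms(2) by auto
  hence "odd p" using assms(1) by fastforce
  thus "2 < p" using \<open>prime p\<close> prime_ge_2_nat[of p] by (cases "p = 2") auto
qed

lemma Jacobi_mult_left:
  assumes "odd n"
  shows "Jacobi (a * b) n = Jacobi a n * Jacobi b n"
proof -
  have "Jacobi (a * b) n = (\<Prod>p\<in>#prime_factorization n. Legendre a (int p) * Legendre b (int p))"
    unfolding Jacobi_def
    by (intro arg_cong[of _ _ prod_mset] image_mset_cong Legendre_mult)
       (use odd_prime_factor_gt_2[OF assms] in auto)
  thus ?thesis by (simp add: Jacobi_def prod_mset.distrib)
qed

lemma Jacobi_values: "Jacobi D n \<in> {-1, 0, 1}"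
proof -
  have "(\<Prod>p\<in>#A. Legendre D (int p)) \<in> {-1, 0, 1}" for A
  proof (induction A)
    case (add x A)
    thus ?case using Legendre_values[of D "int x"] by auto
  qed auto
  thus ?thesis by (simp add: Jacobi_def)
qed

text \<open>Both sides are completely multiplicative on odd numbers, so agreement at odd primes is
  enough. This carries each law for the Legendre symbol over to the Jacobi symbol.\<close>

lemma Jacobi_eqI:
  assumes "odd n" "coprime (int n) D"
    and prime: "\<And>p. prime p \<Longrightarrow> 2 < p \<Longrightarrow> coprime (int p) D \<Longrightarrow> Legendre D (int p) = g p"
    and g1: "g 1 = 1"
    and gm: "\<And>m k. odd m \<Longrightarrow> odd k \<Longrightarrow> g (m * k) = g m * g k"
  shows "Jacobi D n = g n"
  using assms(1,2)
proof (induction n rule: prime_divisors_induct)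
  case zero thus ?case by simp
next
  case (unit x) thus ?case using g1 by simp
next
  case (factor p x)
  have "odd p" "odd x" using factor.prems by auto
  have "2 < p" using \<open>odd p\<close> factor.hyps prime_ge_2_nat[of p] by (cases "p = 2") auto
  have cop: "coprime (int p) D" "coprime (int x) D"
    using factor.prems by auto
  have "x > 0" "p > 0" using \<open>odd x\<close> \<open>odd p\<close> by (auto intro: Nat.gr0I)
  hence "Jacobi D (p * x) = Legendre D p * Jacobi D x"
    using Jacobi_mult_right[of p x D] factor.hyps by (simp add: Jacobi_prime)
  also have "\<dots> = g p * g x"
    using prime[OF factor.hyps \<open>2 < p\<close> cop(1)] factor.IH \<open>odd x\<close> cop(2) by simp
  also have "\<dots> = g (p * x)" using gm \<open>odd p\<close> \<open>odd x\<close> by simp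
  finally show ?case .
qed

lemma Jacobi_minus_one: "odd n \<Longrightarrow> Jacobi (-1) n = sgn4 n"
  by (rule Jacobi_eqI) (auto simp: Legendre_minus_one sgn4_mult, simp add: sgn4_def)

lemma Jacobi_two: "odd n \<Longrightarrow> Jacobi 2 n = sgn8 n"
  by (rule Jacobi_eqI) (auto simp: Legendre_two sgn8_mult, simp add: sgn8_def)

lemma Legendre_one: "p > 1 \<Longrightarrow> Legendre 1 p = 1"
  using zdvd_not_zless[of 1 p] unfolding Legendre_def QuadRes_def
  by (auto simp: cong_0_iff intro!: exI[of _ 1])

lemma Jacobi_odd_prime:
  assumes "prime (p::nat)" "2 < p" "odd n" "coprime n p"
  shows "Jacobi p n = Legendre n p * (if p mod 4 = 1 then 1 else sgn4 n)"
proof (rule Jacobi_eqI)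
  show "Legendre (int p) (int q) = Legendre (int q) (int p) * (if p mod 4 = 1 then 1 else sgn4 q)"
    if "prime q" "2 < q" "coprime (int q) (int p)" for q
    using that assms by (intro Legendre_reciprocity) auto
  show "Legendre (int (m * k)) (int p) * (if p mod 4 = 1 then 1 else sgn4 (m * k)) =
     Legendre (int m) (int p) * (if p mod 4 = 1 then 1 else sgn4 m) *
     (Legendre (int k) (int p) * (if p mod 4 = 1 then 1 else sgn4 k))"
    if "odd m" "odd k" for m k
    using that Legendre_mult[OF assms(1,2)] by (simp add: sgn4_mult)
qed (use assms in \<open>auto simp: Legendre_one sgn4_def\<close>)

lemma Legendre_square:
  assumes "prime (p::nat)" "coprime (int p) s"
  shows "Legendre (s^2) p = 1"
proof -
  have "\<not> int p dvd s"
  proof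
    assume "int p dvd s"
    hence "is_unit (int p)" using assms(2) by (meson coprime_common_divisor dvd_refl)
    thus False using prime_gt_1_nat[OF assms(1)] by simp
  qed
  hence "\<not> int p dvd s^2"
    using assms(1) prime_dvd_power_int[of "int p" s 2] by auto
  thus ?thesis unfolding Legendre_def QuadRes_def by (auto simp: cong_0_iff intro: exI[of _ s])
qed

lemma Jacobi_square:
  assumes "odd n" "coprime (int n) s"
  shows "Jacobi (s^2) n = 1"
  by (rule Jacobi_eqI[of _ _ "\<lambda>_. 1"]) (use assms Legendre_square in auto)

lemma Jacobi_one: "odd n \<Longrightarrow> Jacobi 1 n = 1"
  using Jacobi_square[of n 1] by simp

lemma sgn4_cong: "[int n = int n'] (mod 8) \<Longrightarrow> sgn4 n = sgn4 n'"
proof -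
  assume "[int n = int n'] (mod 8)"
  hence "n mod 8 = n' mod 8" using cong_int_iff[of n n' 8] unfolding Cong.cong_def by simp
  hence "n mod 8 mod 4 = n' mod 8 mod 4" by simp
  hence "n mod 4 = n' mod 4" by (simp add: mod_mod_cancel)
  thus ?thesis by (simp add: sgn4_def)
qed

lemma sgn8_cong: "[int n = int n'] (mod 8) \<Longrightarrow> sgn8 n = sgn8 n'"
proof -
  assume "[int n = int n'] (mod 8)"
  hence "n mod 8 = n' mod 8" using cong_int_iff[of n n' 8] unfolding Cong.cong_def by simp
  thus ?thesis by (simp add: sgn8_def)
qed

text \<open>By multiplicativity in \<open>D\<close> it suffices to treat -1, 2 and odd primes
  \<open>p\<close>. Their symbols depend on \<open>n\<close> modulo 4, modulo 8, and, by
  reciprocity, modulo \<open>4 * p\<close>; all of these are determined by \<open>n\<close> modulo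
  \<open>8 * D\<close>.\<close>

theorem Jacobi_periodic:
  assumes "D \<noteq> 0" "odd n" "coprime (int n) D" "[int n = int n'] (mod 8 * D)"
  shows "Jacobi D n = Jacobi D n'"
  using assms(1,3,4)
proof (induction D rule: prime_divisors_induct)
  case (unit x)
  have c8: "[int n = int n'] (mod 8)" by (rule cong_dvd_modulus[OF unit.prems(3)]) simp
  hence "odd n'" using assms(2) cong_dvd_iff[of "int n" "int n'" 2] cong_dvd_modulus[OF c8, of 2] by simp
  have "x = 1 \<or> x = -1" using unit.hyps by (simp add: zdvd1_eq abs_if split: if_splits)
  thus ?case
    using Jacobi_one Jacobi_minus_one sgn4_cong[OF c8] assms(2) \<open>odd n'\<close> by auto
next
  case (factor p x)
  have c8: "[int n = int n'] (mod 8)" and cp: "[int n = int n'] (mod p)"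
    and cx: "[int n = int n'] (mod 8 * x)"
    by (rule cong_dvd_modulus[OF factor.prems(3)], simp)+
  have "odd n'" using assms(2) cong_dvd_iff[of "int n" "int n'" 2] cong_dvd_modulus[OF c8, of 2] by simp
  have cop: "coprime (int n) p" "coprime (int n) x" using factor.prems(2) by auto
  have "Jacobi x n = Jacobi x n'"
    using factor.IH factor.prems(1) cop cx by simp
  moreover have "Jacobi p n = Jacobi p n'"
  proof (cases "p = 2")
    case True
    thus ?thesis using Jacobi_two assms(2) \<open>odd n'\<close> sgn8_cong[OF c8] by simp
  next
    case False
    define q where "q = nat p"
    have "prime q" and pq: "p = int q"
      using factor.hyps prime_ge_0_int[of p] by (auto simp: q_def prime_nat_iff_prime)
    have "2 < q" using False \<open>prime q\<close> prime_ge_2_nat[of q] pq by linarith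
    have "coprime n q" using cop(1) pq by simp
    have "coprime (int n') p" using cong_imp_coprime[OF cp cop(1)] .
    hence "coprime n' q" using pq by simp
    show ?thesis unfolding pq
      using Jacobi_odd_prime[OF \<open>prime q\<close> \<open>2 < q\<close> assms(2) \<open>coprime n q\<close>]
        Jacobi_odd_prime[OF \<open>prime q\<close> \<open>2 < q\<close> \<open>odd n'\<close> \<open>coprime n' q\<close>]
        Legendre_cong[OF cp] sgn4_cong[OF c8] pq by simp
  qed
  ultimately show ?case
    using Jacobi_mult_left[OF assms(2)] Jacobi_mult_left[OF \<open>odd n'\<close>] by simp
qed auto

text \<open>Squaring modulo \<open>q\<close> identifies 1 and \<open>q - 1\<close>; on a finite set
  a map that is not injective is not surjective, so it misses some residue.\<close>

lemma nonresidue_exists: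
  assumes "prime (q::nat)" "2 < q"
  obtains g :: nat where "Legendre g q = -1"
proof -
  define f where "f = (\<lambda>y. y^2 mod q)"
  have f: "f ` {..<q} \<subseteq> {..<q}" using assms by (auto simp: f_def)
  have "\<not> inj_on f {..<q}"
  proof
    assume "inj_on f {..<q}"
    moreover have "f 1 = f (q - 1)"
    proof -
      have "(q - 1)^2 = 1 + q * (q - 2)"
        using assms(2) by (auto simp: power2_eq_square algebra_simps dest!: less_imp_Suc_add)
      thus ?thesis using assms(2) by (simp add: f_def) (metis mod_Suc_eq mod_mult_self1_is_0 One_nat_def mod_less numeral_2_eq_2 Suc_lessD)
    qed
    ultimately have "1 = q - 1" by (rule inj_onD) (use assms(2) in auto)
    thus False using assms(2) by simp
  qed
  hence "f ` {..<q} \<noteq> {..<q}"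
    by (metis eq_card_imp_inj_on finite_lessThan)
  then obtain g where g: "g < q" "g \<notin> f ` {..<q}" using f by auto
  have "0 \<in> f ` {..<q}" using assms(2) by (intro image_eqI[of _ _ 0]) (auto simp: f_def)
  hence "g \<noteq> 0" using g(2) by metis
  hence "\<not> int q dvd int g" using g(1) by (auto dest: dvd_imp_le)
  moreover have "\<not> QuadRes (int q) (int g)"
  proof
    assume "QuadRes (int q) (int g)"
    then obtain y where y: "[y^2 = int g] (mod int q)" unfolding QuadRes_def by auto
    define z where "z = nat (y mod int q)"
    have z: "z < q" "int z = y mod int q" using assms(2) by (auto simp: z_def nat_less_iff)
    have "int (z^2 mod q) = int g"
      using y g(1) z(2) by (simp add: Cong.cong_def zmod_int power_mod)
    hence "f z = g" by (simp add: f_def)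
    thus False using g(2) z(1) by auto
  qed
  ultimately have "Legendre g q = -1" by (simp add: Legendre_def cong_0_iff)
  thus ?thesis by (rule that)
qed

lemma no_prime_divisor_int:
  fixes x :: int
  assumes "\<And>p. prime p \<Longrightarrow> \<not> p dvd x"
  shows "x = 1 \<or> x = -1"
proof (rule ccontr)
  assume "\<not> ?thesis"
  hence "\<not> is_unit x" by (simp add: zdvd1_eq abs_if split: if_splits)
  moreover have "x \<noteq> 0" using assms[of 2] by auto
  ultimately obtain p where "p dvd x" "prime p" using prime_divisor_exists by blast
  thus False using assms by blast
qed

lemma coprime_1_mod:
  assumes "[int n = 1] (mod m)"
  shows "coprime (int n) m"
  using cong_imp_coprime[OF cong_sym[OF assms]] by simp

text \<open>Only the squarefree part \<open>d\<close> matters, and it is not 1. If an odd prime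
  \<open>q\<close> divides \<open>d\<close>, the Chinese remainder theorem yields an
  \<open>n\<close> that is a nonresidue modulo \<open>q\<close> and trivial for the rest of
  \<open>d\<close>; otherwise \<open>d\<close> is -1, 2 or -2 and a class modulo 8 suffices.\<close>

theorem Jacobi_nonsquare_minus_one:
  fixes D :: int and M :: nat
  assumes "D \<noteq> 0" "\<not> is_square D" "M > 0" "even M" "D dvd int M"
  obtains n where "coprime n M" "Jacobi D n = -1"
proof -
  define d s where "d = squarefree_part D" and "s = square_part D"
  have D: "D = d * s^2" unfolding d_def s_def by (rule squarefree_decompose)
  have sqf: "squarefree d" by (simp add: d_def)
  have "d \<noteq> 1" using assms(2) D by auto
  have "d \<noteq> 0" "s \<noteq> 0" using D assms(1) by auto
  have *: "Jacobi D n = Jacobi d n" if "odd n" "coprime n M" for n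
  proof -
    have "s dvd int M" using assms(5) unfolding D power2_eq_square by (meson dvd_mult_right dvd_trans dvd_triv_left)
    hence "coprime (int n) s"
      using that(2) by (meson coprime_divisors coprime_int_iff dvd_refl)
    thus ?thesis using that(1) by (simp add: D Jacobi_mult_left Jacobi_square)
  qed
  show ?thesis
  proof (cases "\<exists>q. prime q \<and> odd q \<and> q dvd d")
    case True
    then obtain qi where qi: "prime qi" "odd qi" "qi dvd d" by auto
    define q where "q = nat qi"
    have q: "prime q" "qi = int q" using qi prime_ge_0_int[of qi] by (auto simp: q_def prime_nat_iff_prime)
    have "2 < q" using q qi prime_ge_2_nat[of q] by (cases "q = 2") auto
    from qi(3) obtain d' where d': "d = int q * d'" unfolding q by (auto simp: dvd_def)
    have qd': "\<not> int q dvd d'"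
    proof
      assume "int q dvd d'"
      hence "(int q)^2 dvd d" unfolding d' power2_eq_square by (intro mult_dvd_mono) auto
      hence "int q dvd 1" using sqf squarefreeD by blast
      thus False using \<open>2 < q\<close> by simp
    qed
    obtain M' j where M': "M = q ^ j * M'" "\<not> q dvd M'"
      using prime_power_canonical[OF q(1), of M] assms(3) by (metis mult.commute)
    obtain g where g: "Legendre (int g) q = -1" using nonresidue_exists[OF q(1) \<open>2 < q\<close>] by blast
    \<comment> \<open>\<open>K\<close> collects 8, the cofactor of \<open>q\<close> in
      \<open>d\<close>, and the part of \<open>M\<close> prime to \<open>q\<close>. With
      \<open>n\<close> congruent to 1 modulo \<open>K\<close>, the symbol of \<open>d'\<close> is 1
      and the reciprocity sign for \<open>q\<close> disappears.\<close>
    define K where "K = 8 * nat \<bar>d'\<bar> * M'"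
    have "coprime q K"
    proof -
      have "coprime q (2^3)" using \<open>2 < q\<close> q(1) by (intro coprime_power_right_iff[THEN iffD2] disjI1 primes_coprime) auto
      moreover have "coprime q M'" using M'(2) q(1) by (simp add: prime_imp_coprime)
      moreover have "\<not> q dvd nat \<bar>d'\<bar>" using qd' by (simp add: nat_dvd_iff flip: int_dvd_int_iff)
      hence "coprime q (nat \<bar>d'\<bar>)" using q(1) by (simp add: prime_imp_coprime)
      ultimately show ?thesis by (simp add: K_def)
    qed
    then obtain n where n: "[n = g] (mod q)" "[n = 1] (mod K)"
      using binary_chinese_remainder_nat[of q K g 1] by auto
    have nK: "[int n = 1] (mod int K)" using n(2) by (metis cong_int_iff of_nat_1)
    have n8d: "[int n = int 1] (mod 8 * d')"
      by (rule cong_dvd_modulus[of _ _ "int K"]) (use nK in \<open>auto simp: K_def\<close>)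
    have n8: "[int n = int 1] (mod 8)" by (rule cong_dvd_modulus[OF n8d]) simp
    have "odd n" using cong_dvd_modulus[OF n8, of 2] cong_dvd_iff[of "int n" "int 1" 2] by simp
    have Lg: "Legendre (int n) q = -1" using g n(1) Legendre_cong[of "int n" "int g" "int q"] by (simp add: cong_int_iff)
    hence "\<not> q dvd n" by (auto simp: Legendre_def cong_0_iff split: if_splits)
    hence cq: "coprime n q" using q(1) prime_imp_coprime coprime_commute by blast
    have "coprime (int n) (int M')"
      by (rule coprime_1_mod[OF cong_dvd_modulus[OF nK]]) (simp add: K_def)
    hence "coprime n M" using cq unfolding M' by simp
    moreover have "Jacobi D n = -1"
    proof -
      have "coprime (int n) d'" by (rule coprime_1_mod[OF cong_dvd_modulus[OF n8d[simplified]]]) simp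
      have "Jacobi d' n = Jacobi d' 1"
        by (rule Jacobi_periodic[OF _ \<open>odd n\<close> \<open>coprime (int n) d'\<close> n8d]) (use d' \<open>d \<noteq> 0\<close> in auto)
      hence "Jacobi d' n = 1" by simp
      moreover have "Jacobi q n = -1"
        using Jacobi_odd_prime[OF q(1) \<open>2 < q\<close> \<open>odd n\<close> cq] Lg sgn4_cong[OF n8] by (simp add: sgn4_def)
      ultimately show ?thesis
        using *[OF \<open>odd n\<close> \<open>coprime n M\<close>] Jacobi_mult_left[OF \<open>odd n\<close>] d' by simp
    qed
    ultimately show ?thesis by (rule that)
  next
    case False
    have "d \<in> {-1, 2, -2}"
    proof (cases "even d")
      case True
      then obtain e where e: "d = 2 * e" by auto
      have "odd e"
      proof
        assume "even e"
        hence "2^2 dvd d" unfolding e power2_eq_square by (intro mult_dvd_mono) auto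
        hence "(2::int) dvd 1" using sqf squarefreeD by blast
        thus False by simp
      qed
      have "\<not> p dvd e" if "prime p" for p
        using that False \<open>odd e\<close> e by (cases "odd p") (auto simp: prime_int_iff)
      hence "e = 1 \<or> e = -1" by (rule no_prime_divisor_int)
      thus ?thesis using e by auto
    next
      case odd: False
      have "\<not> p dvd d" if "prime p" for p
        using that False odd by (cases "odd p") (auto simp: prime_int_iff)
      hence "d = 1 \<or> d = -1" by (rule no_prime_divisor_int)
      thus ?thesis using \<open>d \<noteq> 1\<close> by auto
    qed
    \<comment> \<open>The class 7 has \<open>sgn4\<close> equal to -1. The class 5 has
      \<open>sgn8\<close> equal to -1 and \<open>sgn4\<close> equal to 1, which serves both 2 and
      -2.\<close>
    define r :: nat where "r = (if d = -1 then 7 else 5)"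
    obtain M' j where M': "M = 2 ^ j * M'" "\<not> 2 dvd M'"
      using prime_power_canonical[OF two_is_prime_nat, of M] assms(3) by (metis mult.commute)
    have "coprime (2^3) M'" using M'(2) by (simp only: coprime_power_left_iff coprime_left_2_iff_odd) simp
    then obtain n where n: "[n = r] (mod 8)" "[n = 1] (mod M')"
      using binary_chinese_remainder_nat[of 8 M' r 1] by auto
    have n8: "n mod 8 = r" using n(1) by (simp add: Cong.cong_def r_def split: if_splits)
    have "odd r" by (simp add: r_def)
    hence "odd n" using n8 by presburger
    have "coprime (int n) (int M')"
      by (rule coprime_1_mod) (use n(2) in \<open>metis cong_int_iff of_nat_1\<close>)
    hence "coprime n M" unfolding M' using \<open>odd n\<close> by simp
    moreover have "Jacobi D n = -1"
    proof -
      have "sgn8 n = (if d = -1 then 1 else -1)" "sgn4 n = (if d = -1 then -1 else 1)"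
        using n8 mod_mod_cancel[of 4 8 n] by (auto simp: sgn8_def sgn4_def r_def split: if_splits)
      moreover have "Jacobi (-2) n = Jacobi (-1) n * Jacobi 2 n"
        using Jacobi_mult_left[OF \<open>odd n\<close>, of "-1" 2] by simp
      ultimately have "Jacobi d n = -1"
        using \<open>d \<in> _\<close> Jacobi_minus_one[OF \<open>odd n\<close>] Jacobi_two[OF \<open>odd n\<close>] by auto
      thus ?thesis using *[OF \<open>odd n\<close> \<open>coprime n M\<close>] by simp
    qed
    ultimately show ?thesis by (rule that)
  qed
qed

section \<open>Quadratic characters\<close>

text \<open>The character is extended by 0 to a modulus \<open>M\<close> shared by all the
  \<open>D\<close> under comparison, so that every Euler factor at a prime dividing \<open>M\<close>
  is 1.\<close>

definition qchar :: "int \<Rightarrow> nat \<Rightarrow> nat \<Rightarrow> real" where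
  "qchar D M n = (if coprime n M then of_int (Jacobi D n) else 0)"

lemma qchar_0 [simp]: "even M \<Longrightarrow> qchar D M 0 = 0"
  by (auto simp: qchar_def)

lemma qchar_1 [simp]: "qchar D M (Suc 0) = 1"
  by (simp add: qchar_def)

lemma qchar_2 [simp]: "even M \<Longrightarrow> qchar D M 2 = 0"
  by (auto simp: qchar_def)

lemma qchar_mult:
  assumes "even M"
  shows "qchar D M (m * n) = qchar D M m * qchar D M n"
proof (cases "coprime m M \<and> coprime n M")
  case True
  hence "m > 0" "n > 0" using assms by (auto intro!: Nat.gr0I)
  thus ?thesis using True by (simp add: qchar_def Jacobi_mult_right)
next
  case False
  thus ?thesis by (auto simp: qchar_def)
qed

lemma qchar_values: "qchar D M n \<in> {-1, 0, 1}"
  using Jacobi_values[of D n] by (auto simp: qchar_def)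

lemma coprime_even_odd: "coprime n M \<Longrightarrow> even M \<Longrightarrow> odd (n::nat)"
  by (meson coprime_common_divisor odd_one)

lemma coprime_dvd_int: "coprime n M \<Longrightarrow> D dvd int M \<Longrightarrow> coprime (int n) D"
  by (meson coprime_divisors coprime_int_iff dvd_refl)

text \<open>The character has period \<open>8 * M\<close>, and multiplication by some
  \<open>c\<close> of value -1 permutes the residues while negating the sum over a period. That sum
  is therefore 0, and only an incomplete period contributes.\<close>

theorem qchar_partial_sums_bounded:
  fixes D :: int and M :: nat
  assumes "D \<noteq> 0" "\<not> is_square D" "M > 0" "even M" "D dvd int M"
  obtains C where "\<And>N. \<bar>\<Sum>n<N. qchar D M n\<bar> \<le> C"
proof -
  define Q where "Q = 8 * M"
  have "Q > 0" using assms(3) by (simp add: Q_def)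
  have per: "qchar D M n = qchar D M n'" if "[n = n'] (mod Q)" for n n'
  proof (cases "coprime n M")
    case True
    have "[n = n'] (mod M)" by (rule cong_dvd_modulus_nat[OF that]) (simp add: Q_def)
    hence "coprime n' M" using True cong_imp_coprime by blast
    have "[int n = int n'] (mod int Q)" using that by (simp add: cong_int_iff)
    hence "[int n = int n'] (mod 8 * D)"
      by (rule cong_dvd_modulus) (use assms(5) in \<open>auto simp: Q_def\<close>)
    hence "Jacobi D n = Jacobi D n'"
      by (intro Jacobi_periodic coprime_even_odd[OF True] coprime_dvd_int[OF True] assms)
    thus ?thesis using True \<open>coprime n' M\<close> by (simp add: qchar_def)
  next
    case False
    have "[n' = n] (mod M)" by (rule cong_dvd_modulus_nat[OF cong_sym[OF that]]) (simp add: Q_def)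
    hence "\<not> coprime n' M" using False cong_imp_coprime by blast
    thus ?thesis using False by (simp add: qchar_def)
  qed
  obtain c where c: "coprime c M" "Jacobi D c = -1"
    using Jacobi_nonsquare_minus_one[OF assms] .
  have "odd c" by (rule coprime_even_odd[OF c(1) assms(4)])
  hence "coprime c 8" using coprime_power_right_iff[of c 2 3] by simp
  hence cQ: "coprime c Q" using c(1) by (simp add: Q_def)
  have inj: "inj_on (\<lambda>n. c * n mod Q) {..<Q}"
  proof (rule inj_onI)
    fix x y assume xy: "x \<in> {..<Q}" "y \<in> {..<Q}" "c * x mod Q = c * y mod Q"
    hence "[c * x = c * y] (mod Q)" by (simp add: Cong.cong_def)
    hence "[x = y] (mod Q)" using cQ cong_mult_lcancel_nat by blast
    thus "x = y" using xy by (simp add: Cong.cong_def)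
  qed
  \<comment> \<open>An injective self-map of a finite set is onto, so the sum over a period may be
    reindexed by \<open>c * n\<close>.\<close>
  have img: "(\<lambda>n. c * n mod Q) ` {..<Q} = {..<Q}"
    using inj \<open>Q > 0\<close> by (intro endo_inj_surj) auto
  have "(\<Sum>n<Q. qchar D M n) = (\<Sum>n<Q. qchar D M (c * n mod Q))"
    using sum.reindex[OF inj, of "qchar D M"] unfolding img by simp
  also have "\<dots> = (\<Sum>n<Q. qchar D M (c * n))"
    by (intro sum.cong per refl) (simp add: Cong.cong_def)
  also have "\<dots> = - (\<Sum>n<Q. qchar D M n)"
  proof -
    have "qchar D M c = -1" using c by (simp add: qchar_def)
    thus ?thesis by (simp add: qchar_mult[OF assms(4)] sum_negf)
  qed
  finally have zero: "(\<Sum>n<Q. qchar D M n) = 0" by simp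
  have shift: "(\<Sum>n<N + Q. qchar D M n) = (\<Sum>n<N. qchar D M n)" for N
  proof -
    have "(\<Sum>n<Q + N. qchar D M n) = (\<Sum>n<Q. qchar D M n) + (\<Sum>n<N. qchar D M (Q + n))"
      by (induction N) auto
    also have "(\<Sum>n<N. qchar D M (Q + n)) = (\<Sum>n<N. qchar D M n)"
      by (intro sum.cong per refl) (simp add: Cong.cong_def)
    finally show ?thesis using zero by (simp add: add.commute)
  qed
  have "\<bar>\<Sum>n<N. qchar D M n\<bar> \<le> real Q" for N
  proof (induction N rule: less_induct)
    case (less N)
    show ?case
    proof (cases "N < Q")
      case True
      have "\<bar>\<Sum>n<N. qchar D M n\<bar> \<le> (\<Sum>n<N. \<bar>qchar D M n\<bar>)" by (rule sum_abs)
      also have "\<dots> \<le> (\<Sum>n<N. 1)"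
      proof (rule sum_mono)
        show "\<bar>qchar D M n\<bar> \<le> 1" for n using qchar_values[of D M n] by auto
      qed
      finally show ?thesis using True by simp
    next
      case False
      thus ?thesis using less.IH[of "N - Q"] shift[of "N - Q"] \<open>Q > 0\<close> by simp
    qed
  qed
  thus ?thesis by (rule that)
qed

section \<open>Summation by parts and divisor sums\<close>

lemma abel_summation_bound:
  fixes a b :: "nat \<Rightarrow> real"
  assumes S: "\<And>N. \<bar>\<Sum>n<N. a n\<bar> \<le> C"
    and dec: "\<And>n. n \<ge> m \<Longrightarrow> b (Suc n) \<le> b n"
    and nn: "\<And>n. n \<ge> m \<Longrightarrow> 0 \<le> b n"
    and "m \<le> N"
  shows "\<bar>\<Sum>n=m..<N. a n * b n\<bar> \<le> 2 * C * b m"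
proof -
  define S where "S = (\<lambda>N. \<Sum>n<N. a n)"
  \<comment> \<open>Summation by parts; afterwards the nonnegative differences of \<open>b\<close>
    telescope to \<open>b m - b N\<close>.\<close>
  have parts: "(\<Sum>n=m..<N. a n * b n) =
      S N * b N - S m * b m + (\<Sum>n=m..<N. S (Suc n) * (b n - b (Suc n)))"
    using \<open>m \<le> N\<close> by (induction N rule: dec_induct) (simp_all add: S_def algebra_simps)
  have C: "\<bar>S k\<bar> \<le> C" for k using assms(1) by (simp add: S_def)
  have "C \<ge> 0" using C[of 0] by linarith
  have "\<bar>S N * b N\<bar> \<le> C * b N"
    unfolding abs_mult using C[of N] nn[of N] \<open>m \<le> N\<close> by (intro mult_mono) auto
  moreover have "\<bar>S m * b m\<bar> \<le> C * b m"
    unfolding abs_mult using C[of m] nn[of m] \<open>m \<le> N\<close> by (intro mult_mono) auto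
  moreover have "\<bar>\<Sum>n=m..<N. S (Suc n) * (b n - b (Suc n))\<bar> \<le> C * (b m - b N)"
  proof -
    have "\<bar>\<Sum>n=m..<N. S (Suc n) * (b n - b (Suc n))\<bar> \<le> (\<Sum>n=m..<N. C * (b n - b (Suc n)))"
    proof (rule order.trans[OF sum_abs], rule sum_mono)
      fix n assume "n \<in> {m..<N}"
      thus "\<bar>S (Suc n) * (b n - b (Suc n))\<bar> \<le> C * (b n - b (Suc n))"
        unfolding abs_mult using C[of "Suc n"] dec[of n] \<open>C \<ge> 0\<close> by (intro mult_mono) auto
    qed
    also have "\<dots> = C * (b m - b N)"
      using \<open>m \<le> N\<close> by (induction N rule: dec_induct) (simp_all add: algebra_simps)
    finally show ?thesis .
  qed
  ultimately have "\<bar>\<Sum>n=m..<N. a n * b n\<bar> \<le> C * b N + C * b m + C * (b m - b N)"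
    unfolding parts by linarith
  thus ?thesis by (simp add: algebra_simps)
qed

text \<open>The block bound gives the Cauchy criterion, and in the limit the tail estimate.
  Monotonicity is required from 1 on, because weights such as \<open>1 / real n\<close> have the
  default value 0 at \<open>n = 0\<close>.\<close>

lemma dirichlet_test:
  fixes a b :: "nat \<Rightarrow> real"
  assumes S: "\<And>N. \<bar>\<Sum>n<N. a n\<bar> \<le> C"
    and dec: "\<And>n. n \<ge> 1 \<Longrightarrow> b (Suc n) \<le> b n"
    and nn: "\<And>n. n \<ge> 1 \<Longrightarrow> 0 \<le> b n"
    and lim: "b \<longlonglongrightarrow> 0"
  shows "summable (\<lambda>n. a n * b n)"
    and "m \<ge> 1 \<Longrightarrow> \<bar>(\<Sum>n. a n * b n) - (\<Sum>n<m. a n * b n)\<bar> \<le> 2 * C * b m"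
proof -
  have bound: "\<bar>\<Sum>n=m..<N. a n * b n\<bar> \<le> 2 * C * b m" if "m \<ge> 1" "m \<le> N" for m N
    by (rule abel_summation_bound) (use that S dec nn in auto)
  show summ: "summable (\<lambda>n. a n * b n)"
    unfolding summable_Cauchy
  proof (intro allI impI)
    fix e :: real assume "e > 0"
    have "(\<lambda>m. 2 * C * b m) \<longlonglongrightarrow> 2 * C * 0" by (intro tendsto_intros lim)
    hence "eventually (\<lambda>m. 2 * C * b m < e) sequentially"
      using \<open>e > 0\<close> by (intro order_tendstoD(2)) auto
    hence "eventually (\<lambda>m. 2 * C * b m < e \<and> m \<ge> 1) sequentially"
      using eventually_ge_at_top[of 1] by (rule eventually_conj)
    then obtain M where M: "\<And>m. m \<ge> M \<Longrightarrow> 2 * C * b m < e \<and> m \<ge> 1"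
      unfolding eventually_sequentially by blast
    show "\<exists>M. \<forall>m\<ge>M. \<forall>n. norm (\<Sum>n=m..<n. a n * b n) < e"
    proof (intro exI allI impI)
      fix m n assume "m \<ge> M"
      show "norm (\<Sum>n=m..<n. a n * b n) < e"
      proof (cases "m \<le> n")
        case True
        thus ?thesis using bound[of m n] M[OF \<open>m \<ge> M\<close>] by simp
      qed (use \<open>e > 0\<close> in simp)
    qed
  qed
  assume "m \<ge> 1"
  have "(\<lambda>N. (\<Sum>n<N. a n * b n) - (\<Sum>n<m. a n * b n)) \<longlonglongrightarrow> (\<Sum>n. a n * b n) - (\<Sum>n<m. a n * b n)"
    by (intro tendsto_intros summable_LIMSEQ summ)
  hence "(\<lambda>N. \<bar>(\<Sum>n<N. a n * b n) - (\<Sum>n<m. a n * b n)\<bar>) \<longlonglongrightarrow> \<bar>(\<Sum>n. a n * b n) - (\<Sum>n<m. a n * b n)\<bar>"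
    by (rule tendsto_rabs)
  moreover have "eventually (\<lambda>N. \<bar>(\<Sum>n<N. a n * b n) - (\<Sum>n<m. a n * b n)\<bar> \<le> 2 * C * b m) sequentially"
    using eventually_ge_at_top[of m]
  proof eventually_elim
    case (elim N)
    have "(\<Sum>n<N. a n * b n) - (\<Sum>n<m. a n * b n) = (\<Sum>n=m..<N. a n * b n)"
      using sum_diff_nat_ivl[of 0 m N "\<lambda>n. a n * b n"] elim by (simp add: atLeast0LessThan)
    thus ?case using bound[OF \<open>m \<ge> 1\<close> elim] by simp
  qed
  ultimately show "\<bar>(\<Sum>n. a n * b n) - (\<Sum>n<m. a n * b n)\<bar> \<le> 2 * C * b m"
    by (rule tendsto_upperbound) simp
qed

text \<open>Each divisor of \<open>a * b\<close> is uniquely a divisor of \<open>a\<close> times a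
  divisor of \<open>b\<close>.\<close>

lemma divisor_sum_mult_coprime:
  fixes f :: "nat \<Rightarrow> real"
  assumes "coprime a b" "a > 0" "b > 0" and mult: "\<And>m n. f (m * n) = f m * f n"
  shows "(\<Sum>d | d dvd a * b. f d) = (\<Sum>d | d dvd a. f d) * (\<Sum>d | d dvd b. f d)"
proof -
  have inj: "inj_on (\<lambda>(x, y). x * y) ({d. d dvd a} \<times> {d. d dvd b})"
  proof (rule inj_onI, clarify)
    fix x y x' y' assume *: "x dvd a" "y dvd b" "x' dvd a" "y' dvd b" "x * y = x' * y'"
    have cop: "coprime x y'" "coprime x' y" using * assms(1) coprime_divisors by blast+
    have "x dvd x'" using *(5) cop(1) by (metis coprime_dvd_mult_left_iff dvd_triv_left)
    moreover have "x' dvd x" using *(5) cop(2) by (metis coprime_dvd_mult_left_iff dvd_triv_left)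
    ultimately have "x = x'" by (rule dvd_antisym)
    moreover have "x > 0" using *(1) assms(2) by (auto intro: Nat.gr0I)
    ultimately show "x = x' \<and> y = y'" using *(5) by auto
  qed
  have img: "(\<lambda>(x, y). x * y) ` ({d. d dvd a} \<times> {d. d dvd b}) = {d. d dvd a * b}"
    using division_decomp[of _ a b] by (auto simp: image_iff intro!: mult_dvd_mono)
  have "(\<Sum>d | d dvd a * b. f d) = (\<Sum>(x, y)\<in>{d. d dvd a} \<times> {d. d dvd b}. f (x * y))"
    unfolding img[symmetric] sum.reindex[OF inj] by (simp add: case_prod_unfold o_def)
  thus ?thesis by (simp add: mult sum_product sum.cartesian_product)
qed

lemma divisor_sum_prime_power:
  fixes f :: "nat \<Rightarrow> real"
  assumes "prime p" "f 1 = 1" and mult: "\<And>m n. f (m * n) = f m * f n"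
  shows "(\<Sum>d | d dvd p ^ k. f d) = (\<Sum>i\<le>k. f p ^ i)"
proof -
  have pw: "f (p ^ i) = f p ^ i" for i by (induction i) (use assms in auto)
  have "{d. d dvd p ^ k} = (\<lambda>i. p ^ i) ` {..k}"
    using divides_primepow_nat[OF assms(1)] by auto
  moreover have "inj_on (\<lambda>i. p ^ i) {..k}"
    using prime_gt_1_nat[OF assms(1)] by (auto intro!: inj_onI)
  ultimately show ?thesis by (simp add: sum.reindex pw)
qed

text \<open>The divisor sum is multiplicative, and at a prime power it is 1 + t + ... + t^k with t
  in {-1, 0, 1}; for t = -1 this alternates between 1 and 0.\<close>

lemma divisor_sum_nonneg:
  fixes f :: "nat \<Rightarrow> real"
  assumes "f 1 = 1" and mult: "\<And>m n. f (m * n) = f m * f n" and vals: "\<And>n. f n \<in> {-1, 0, 1}"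
    and "N > 0"
  shows "(\<Sum>d | d dvd N. f d) \<ge> 0"
  using \<open>N > 0\<close>
proof (induction N rule: less_induct)
  case (less N)
  show ?case
  proof (cases "N = 1")
    case False
    then obtain p where p: "prime p" "p dvd N" using prime_factor_nat by blast
    obtain m k where mk: "N = p ^ k * m" "\<not> p dvd m"
      using prime_power_canonical[OF p(1) less.prems] by (metis mult.commute)
    have "k > 0" using p mk by (cases k) auto
    hence "1 < p ^ k" using prime_gt_1_nat[OF p(1)] by (intro one_less_power)
    moreover have "m > 0" using less.prems mk by (auto intro: Nat.gr0I)
    ultimately have "m < N" using mk by simp
    have "coprime (p ^ k) m" using p(1) mk(2) by (simp add: prime_imp_coprime)
    hence "(\<Sum>d | d dvd N. f d) = (\<Sum>i\<le>k. f p ^ i) * (\<Sum>d | d dvd m. f d)"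
      unfolding mk using prime_gt_0_nat[OF p(1)] \<open>m > 0\<close>
      by (subst divisor_sum_mult_coprime[OF _ _ _ mult])
         (use divisor_sum_prime_power[OF p(1) assms(1) mult] in auto)
    moreover have "(\<Sum>i\<le>k. t ^ i) \<ge> 0" if "t \<in> {-1, 0, 1}" for t :: real
    proof -
      have "(\<Sum>i\<le>k. (-1) ^ i) = (if even k then 1 else 0 :: real)" by (induction k) auto
      moreover have "(\<Sum>i\<le>k. t ^ i) \<ge> 0" if "t \<ge> 0" using that by (intro sum_nonneg) simp
      ultimately show ?thesis using that by (cases "t = -1") (auto split: if_splits)
    qed
    ultimately show ?thesis
      using less.IH[OF \<open>m < N\<close> \<open>m > 0\<close>] vals[of p] by simp
  qed (use assms in simp)
qed

section \<open>Dirichlet series of real characters\<close>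

text \<open>The inequality between arithmetic and geometric means, applied to the terms of index
  \<open>i\<close> and \<open>n - i\<close>.\<close>

lemma geometric_sum_ge:
  fixes y :: real
  assumes "y \<ge> 0"
  shows "(\<Sum>i\<le>n. (y^2)^i) \<ge> (real n + 1) * y ^ n"
proof -
  have "(\<Sum>i\<le>n. (y^2)^i) = (\<Sum>i\<le>n. (y^2)^(n - i))"
    by (rule sum.reindex_bij_witness[of _ "\<lambda>i. n - i" "\<lambda>i. n - i"]) auto
  hence "2 * (\<Sum>i\<le>n. (y^2)^i) = (\<Sum>i\<le>n. (y^2)^i + (y^2)^(n - i))"
    by (simp add: sum.distrib)
  also have "\<dots> \<ge> (\<Sum>i\<le>n. 2 * y ^ n)"
  proof (rule sum_mono)
    fix i assume "i \<in> {..n}"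
    hence "y ^ n = y ^ i * y ^ (n - i)" by (simp flip: power_add)
    thus "2 * y ^ n \<le> (y^2)^i + (y^2)^(n - i)"
      using sum_squares_bound[of "y ^ i" "y ^ (n - i)"]
      by (simp add: power2_eq_square power_mult_distrib mult.assoc)
  qed
  finally show ?thesis by (simp add: algebra_simps)
qed

text \<open>The Lambert kernel \<open>x ^ n / (1 - x ^ n)\<close> subtracted from its leading
  behaviour \<open>1 / (n * (1 - x))\<close> as \<open>x\<close> tends to 1.\<close>

definition lambert_weight :: "real \<Rightarrow> nat \<Rightarrow> real" where
  "lambert_weight x n = 1 / (real n * (1 - x)) - x ^ n / (1 - x ^ n)"

text \<open>With \<open>A n = 1 + x + ... + x^(n-1)\<close> the weight is
  \<open>(1 / n - x ^ n / A n) / (1 - x)\<close>. Its decrease amounts to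
  \<open>n * (n + 1) * x ^ n \<le> A n * A (n + 1)\<close>, which follows from the mean inequality
  for \<open>A\<close>.\<close>

lemma lambert_weight:
  assumes "0 < x" "x < 1"
  shows "n \<ge> 1 \<Longrightarrow> lambert_weight x (Suc n) \<le> lambert_weight x n"
    and "n \<ge> 1 \<Longrightarrow> lambert_weight x n \<ge> 0"
    and "lambert_weight x \<longlonglongrightarrow> 0"
    and "lambert_weight x 1 = 1"
proof -
  define A where "A = (\<lambda>n. \<Sum>i<n. x ^ i)"
  \<comment> \<open>The mean inequality bounds \<open>A n\<close> below by \<open>n\<close> times
    x^((n-1)/2); the square root keeps the exponents natural numbers.\<close>
  define y where "y = sqrt x"
  have y: "0 < y" "y < 1" "x = y^2" using assms by (auto simp: y_def)
  have A_eq: "1 - x ^ n = (1 - x) * A n" for n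
    unfolding A_def by (rule one_diff_power_eq)
  have A_ge: "A n \<ge> real n * y ^ (n - 1)" if "n \<ge> 1" for n
    using geometric_sum_ge[of y "n - 1"] that y
    by (simp add: A_def lessThan_Suc_atMost[symmetric])
  have A_pos: "A n > 0" if "n \<ge> 1" for n
    using A_ge[OF that] y that by (intro less_le_trans[OF _ A_ge[OF that]]) auto
  have w: "lambert_weight x n = (1 / n - x ^ n / A n) / (1 - x)" if "n \<ge> 1" for n
    unfolding lambert_weight_def A_eq by (simp add: diff_divide_distrib mult.commute)
  {
    assume n: "n \<ge> 1"
    have "y ^ (2 * n) \<le> y ^ (n - 1)" using y by (intro power_decreasing) auto
    hence "real n * y ^ (2 * n) \<le> real n * y ^ (n - 1)" by (intro mult_left_mono) auto
    also have "\<dots> \<le> A n" by (rule A_ge[OF n])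
    finally have "real n * x ^ n \<le> A n" by (simp add: y(3) power_mult)
    hence "x ^ n / A n \<le> 1 / n" using A_pos[OF n] n by (simp add: field_simps)
    thus "lambert_weight x n \<ge> 0" unfolding w[OF n] using assms by simp
    have "real n * real (n + 1) * x ^ n \<le> real n * real (n + 1) * y ^ (2 * n - 1)"
      unfolding y(3) power_mult[symmetric] using y by (intro mult_left_mono power_decreasing) auto
    also have "\<dots> = (real n * y ^ (n - 1)) * (real (n + 1) * y ^ n)"
    proof -
      have "y ^ (2 * n - 1) = y ^ (n - 1) * y ^ n"
        using n by (simp flip: power_add add: mult_2)
      thus ?thesis by simp
    qed
    also have "\<dots> \<le> A n * A (Suc n)"
      using A_ge[OF n] A_ge[of "Suc n"] y A_pos[OF n] by (intro mult_mono) auto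
    finally have AA: "real n * real (n + 1) * x ^ n \<le> A n * A (Suc n)" .
    have rec: "A (Suc n) = 1 + x * A n"
      unfolding A_def by (subst sum.lessThan_Suc_shift) (simp add: sum_distrib_left)
    have "x ^ n / A n - x ^ Suc n / A (Suc n) = x ^ n * (A (Suc n) - x * A n) / (A n * A (Suc n))"
      using A_pos[OF n] A_pos[of "Suc n"] by (simp add: field_simps)
    also have "\<dots> = x ^ n / (A n * A (Suc n))" by (simp add: rec)
    also have "\<dots> \<le> 1 / (real n * real (n + 1))"
      using AA A_pos[OF n] A_pos[of "Suc n"] n by (simp add: divide_simps mult.commute)
    also have "\<dots> = 1 / real n - 1 / real (Suc n)" using n by (simp add: field_simps)
    finally have "1 / real (Suc n) - x ^ Suc n / A (Suc n) \<le> 1 / real n - x ^ n / A n"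
      by linarith
    thus "lambert_weight x (Suc n) \<le> lambert_weight x n"
      unfolding w[OF n] w[of "Suc n", simplified] using assms by (intro divide_right_mono) auto
  }
  have "(\<lambda>n. 1 / (1 - x) * inverse (real n) - x ^ n / (1 - x ^ n)) \<longlonglongrightarrow> 1 / (1 - x) * 0 - 0 / (1 - 0)"
    using assms by (intro tendsto_intros lim_inverse_n LIMSEQ_realpow_zero) auto
  moreover have "lambert_weight x = (\<lambda>n. 1 / (1 - x) * inverse (real n) - x ^ n / (1 - x ^ n))"
    by (auto simp: lambert_weight_def field_simps)
  ultimately show "lambert_weight x \<longlonglongrightarrow> 0" by simp
  show "lambert_weight x 1 = 1" unfolding lambert_weight_def using assms by (simp add: field_simps)
qed

text \<open>Interchange of summation with \<open>N = d * j\<close>; the bound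
  \<open>N \<le> M\<close> becomes \<open>j \<le> M div d\<close>.\<close>

lemma lambert_partial_sum:
  fixes f :: "nat \<Rightarrow> real" and x :: real
  shows "(\<Sum>N=1..M. (\<Sum>d | d dvd N. f d) * x ^ N) = (\<Sum>d=1..M. f d * (\<Sum>j=1..M div d. (x ^ d) ^ j))"
proof -
  have "(\<Sum>N=1..M. (\<Sum>d | d dvd N. f d) * x ^ N) = (\<Sum>N=1..M. \<Sum>d=1..M. if d dvd N then f d * x ^ N else 0)"
  proof (rule sum.cong[OF refl])
    fix N assume N: "N \<in> {1..M}"
    hence "{d. d dvd N} = {d \<in> {1..M}. d dvd N}"
      by (auto dest: dvd_imp_le intro: Suc_leI Nat.gr0I)
    thus "(\<Sum>d | d dvd N. f d) * x ^ N = (\<Sum>d=1..M. if d dvd N then f d * x ^ N else 0)"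
      by (simp only: sum.inter_filter[OF finite_atLeastAtMost] sum_distrib_right)
         (intro sum.cong, auto)
  qed
  also have "\<dots> = (\<Sum>d=1..M. \<Sum>N=1..M. if d dvd N then f d * x ^ N else 0)"
    by (rule sum.swap)
  also have "\<dots> = (\<Sum>d=1..M. f d * (\<Sum>j=1..M div d. (x ^ d) ^ j))"
  proof (rule sum.cong[OF refl])
    fix d assume d: "d \<in> {1..M}"
    have "(\<Sum>N=1..M. if d dvd N then f d * x ^ N else 0) = (\<Sum>N | N \<in> {1..M} \<and> d dvd N. f d * x ^ N)"
      by (simp only: sum.inter_filter[OF finite_atLeastAtMost])
    also have "\<dots> = (\<Sum>j=1..M div d. f d * (x ^ d) ^ j)"
      by (rule sum.reindex_bij_witness[of _ "\<lambda>j. d * j" "\<lambda>N. N div d"])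
         (use d in \<open>auto simp: div_le_mono less_eq_div_iff_mult_less_eq mult.commute simp flip: power_mult elim!: dvdE\<close>)
    finally show "(\<Sum>N=1..M. if d dvd N then f d * x ^ N else 0) = f d * (\<Sum>j=1..M div d. (x ^ d) ^ j)"
      by (simp add: sum_distrib_left)
  qed
  finally show ?thesis .
qed

text \<open>The omitted terms sum to \<open>x ^ (d * Suc K) / (1 - x ^ d)\<close> with
  \<open>K = M div d\<close>, and \<open>d * Suc K \<ge> M\<close>. The resulting bound is uniform
  in \<open>d\<close>.\<close>

lemma geometric_tail:
  fixes x :: real
  assumes "0 < x" "x < 1" "d \<ge> 1"
  shows "\<bar>x ^ d / (1 - x ^ d) - (\<Sum>j=1..M div d. (x ^ d) ^ j)\<bar> \<le> x ^ M / (1 - x)"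
proof -
  define K where "K = M div d"
  have xd: "x ^ d < 1" "0 < x ^ d" using assms by (auto simp: power_less_one_iff)
  have "(1 - x ^ d) * (\<Sum>j=1..K. (x ^ d) ^ j) = x ^ d - (x ^ d) ^ Suc K"
  proof (induction K)
    case (Suc K)
    have "(1 - x ^ d) * (\<Sum>j=1..Suc K. (x ^ d) ^ j) =
        (1 - x ^ d) * (\<Sum>j=1..K. (x ^ d) ^ j) + (1 - x ^ d) * (x ^ d) ^ Suc K"
      by (simp add: distrib_left)
    also have "\<dots> = x ^ d - (x ^ d) ^ Suc K + (1 - x ^ d) * (x ^ d) ^ Suc K"
      by (simp only: Suc.IH)
    also have "\<dots> = x ^ d - (x ^ d) ^ Suc (Suc K)"
      by (simp add: left_diff_distrib)
    finally show ?case .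
  qed simp
  hence "(\<Sum>j=1..K. (x ^ d) ^ j) = (x ^ d - (x ^ d) ^ Suc K) / (1 - x ^ d)"
    using xd by (simp add: eq_divide_eq mult.commute)
  hence "x ^ d / (1 - x ^ d) - (\<Sum>j=1..K. (x ^ d) ^ j) = x ^ (d * Suc K) / (1 - x ^ d)"
    by (simp only: diff_divide_distrib[symmetric] power_mult) simp
  moreover have "x ^ (d * Suc K) / (1 - x ^ d) \<le> x ^ M / (1 - x)"
  proof (rule frac_le)
    have "M \<le> d * Suc K"
      using mult_div_mod_eq[of d M] mod_less_divisor[of d M] assms(3) unfolding K_def
      by (metis add_left_mono less_imp_le_nat less_le_trans mult_Suc_right add.commute zero_less_one)
    thus "x ^ (d * Suc K) \<le> x ^ M" using assms by (intro power_decreasing) auto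
    show "1 - x \<le> 1 - x ^ d" using assms power_decreasing[of 1 d x] by simp
  qed (use assms in auto)
  moreover have "x ^ (d * Suc K) / (1 - x ^ d) \<ge> 0" using assms xd by simp
  ultimately show ?thesis unfolding K_def[symmetric] by (simp only: abs_of_nonneg)
qed

text \<open>A nontrivial real character in abstract form: boundedness of the partial sums replaces
  periodicity and excludes the principal characters.\<close>

locale real_character =
  fixes f :: "nat \<Rightarrow> real" and C :: real
  assumes f0: "f 0 = 0" and f1: "f 1 = 1"
    and mult: "f (m * n) = f m * f n"
    and vals: "f n \<in> {-1, 0, 1}"
    and bounded: "\<bar>\<Sum>n<N. f n\<bar> \<le> C"
begin

lemma abs_le_1: "\<bar>f n\<bar> \<le> 1"
  using vals[of n] by auto

text \<open>
Monsky's argument. If the sum vanished, the Lambert series with terms \<open>f n x^n / (1 - x^n)\<close> would be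
minus the sum of \<open>f n\<close> times \<open>lambert_weight x n\<close>, whose weights decrease from 1 to 0, hence
bounded for \<open>0 < x < 1\<close>.
But its power series has the divisor sums of \<open>f\<close> as coefficients; these are nonnegative, and equal
to 1 at the powers of 2.
\<close>

theorem sum_over_n_nonzero:
  assumes f2: "f 2 = 0"
  shows "(\<Sum>n. f n * (1 / real n)) \<noteq> 0"
proof
  assume zero: "(\<Sum>n. f n * (1 / real n)) = 0"
  have summ: "summable (\<lambda>n. f n * (1 / real n))"
    by (rule dirichlet_test(1)[OF bounded]) (auto simp: lim_1_over_n field_simps)
  \<comment> \<open>The constant \<open>2 * C\<close> depends neither on \<open>x\<close> nor on
    \<open>K\<close>; the contradiction comes from letting \<open>x\<close> approach 1 as
    \<open>K\<close> grows.\<close>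
  have bound: "(\<Sum>k<K. x ^ (2 ^ k)) \<le> 2 * C" if x: "0 < x" "x < 1" for x :: real and K
  proof -
    have sw: "summable (\<lambda>n. f n * lambert_weight x n)"
      by (rule dirichlet_test(1)[OF bounded lambert_weight(1)[OF x] lambert_weight(2)[OF x] lambert_weight(3)[OF x]])
    have "\<bar>(\<Sum>n. f n * lambert_weight x n) - (\<Sum>n<1. f n * lambert_weight x n)\<bar> \<le> 2 * C * lambert_weight x 1"
      by (rule dirichlet_test(2)[OF bounded lambert_weight(1)[OF x] lambert_weight(2)[OF x] lambert_weight(3)[OF x]]) auto
    hence b: "\<bar>\<Sum>n. f n * lambert_weight x n\<bar> \<le> 2 * C"
      unfolding lambert_weight(4)[OF x] by (simp add: f0)
    have eq: "f n * (x ^ n / (1 - x ^ n)) =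
        1 / (1 - x) * (f n * (1 / real n)) - f n * lambert_weight x n" for n
      by (simp add: lambert_weight_def algebra_simps)
    have "(\<lambda>n. f n * (x ^ n / (1 - x ^ n))) sums
        (1 / (1 - x) * 0 - (\<Sum>n. f n * lambert_weight x n))"
      unfolding eq using summable_sums[OF summ] summable_sums[OF sw]
      unfolding zero by (intro sums_diff sums_mult)
    from LIMSEQ_Suc[OF this[unfolded sums_def]] have "(\<lambda>M. \<Sum>d<Suc M. f d * (x ^ d / (1 - x ^ d))) \<longlonglongrightarrow> - (\<Sum>n. f n * lambert_weight x n)"
      by simp
    moreover have "(\<Sum>d<Suc M. f d * (x ^ d / (1 - x ^ d))) = (\<Sum>d=1..M. f d * (x ^ d / (1 - x ^ d)))" for M
      by (simp add: lessThan_Suc_atMost atMost_atLeast0 sum.atLeast_Suc_atMost[of 0] f0)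
    ultimately have lim: "(\<lambda>M. \<Sum>d=1..M. f d * (x ^ d / (1 - x ^ d))) \<longlonglongrightarrow> - (\<Sum>n. f n * lambert_weight x n)"
      by simp
    define G where "G = (\<lambda>M. \<Sum>N=1..M. (\<Sum>d | d dvd N. f d) * x ^ N)"
    \<comment> \<open>Truncating the geometric series costs at most \<open>x ^ M / (1 - x)\<close>
      for each of the \<open>M\<close> values of \<open>d\<close>, and \<open>M * x ^ M\<close>
      tends to 0. Hence the power series has the same limit as the Lambert series.\<close>
    have diff: "\<bar>(\<Sum>d=1..M. f d * (x ^ d / (1 - x ^ d))) - G M\<bar> \<le> real M * x ^ M / (1 - x)" for M
    proof -
      have "(\<Sum>d=1..M. f d * (x ^ d / (1 - x ^ d))) - G M =
          (\<Sum>d=1..M. f d * (x ^ d / (1 - x ^ d) - (\<Sum>j=1..M div d. (x ^ d) ^ j)))"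
        unfolding G_def lambert_partial_sum by (simp add: sum_subtractf right_diff_distrib)
      also have "\<bar>\<dots>\<bar> \<le> (\<Sum>d=1..M. x ^ M / (1 - x))"
      proof (rule order.trans[OF sum_abs], rule sum_mono)
        fix d assume "d \<in> {1..M}"
        hence "\<bar>x ^ d / (1 - x ^ d) - (\<Sum>j=1..M div d. (x ^ d) ^ j)\<bar> \<le> x ^ M / (1 - x)"
          by (intro geometric_tail x) auto
        thus "\<bar>f d * (x ^ d / (1 - x ^ d) - (\<Sum>j=1..M div d. (x ^ d) ^ j))\<bar> \<le> x ^ M / (1 - x)"
          unfolding abs_mult using abs_le_1[of d] mult_mono[of "\<bar>f d\<bar>" 1] by fastforce
      qed
      finally show ?thesis by simp
    qed
    have "(\<lambda>M. real M * x ^ M / (1 - x)) \<longlonglongrightarrow> 0 / (1 - x)"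
      using x by (intro tendsto_intros powser_times_n_limit_0) auto
    hence "(\<lambda>M. (\<Sum>d=1..M. f d * (x ^ d / (1 - x ^ d))) - G M) \<longlonglongrightarrow> 0"
      by (rule Lim_null_comparison[rotated, OF tendsto_eq_rhs]) (use diff in auto)
    from tendsto_diff[OF lim this] have Glim: "G \<longlonglongrightarrow> - (\<Sum>n. f n * lambert_weight x n)"
      by simp
    have "eventually (\<lambda>M. (\<Sum>k<K. x ^ (2 ^ k)) \<le> G M) sequentially"
      using eventually_ge_at_top[of "2 ^ K"]
    proof eventually_elim
      case (elim M)
      \<comment> \<open>As \<open>f 2 = 0\<close>, the divisor 1 alone contributes.\<close>
      have r2: "(\<Sum>d | d dvd 2 ^ k. f d) = 1" for k :: nat
        using divisor_sum_prime_power[OF two_is_prime_nat f1 mult, of k]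
        by (simp add: f2 power_0_left sum.atMost_shift)
      have "(\<Sum>k<K. x ^ (2 ^ k)) = (\<Sum>N\<in>(\<lambda>k. 2 ^ k) ` {..<K}. (\<Sum>d | d dvd N. f d) * x ^ N)"
        by (subst sum.reindex) (auto simp: inj_on_def r2)
      also have "\<dots> \<le> G M" unfolding G_def
      proof (rule sum_mono2)
        have "2 ^ k \<le> M" if "k < K" for k
          using elim that power_increasing[of k K "2::nat"] by linarith
        thus "(\<lambda>k. 2 ^ k) ` {..<K} \<subseteq> {1..M}" by auto
        show "0 \<le> (\<Sum>d | d dvd N. f d) * x ^ N" if "N \<in> {1..M} - (\<lambda>k. 2 ^ k) ` {..<K}" for N
          using that x by (intro mult_nonneg_nonneg divisor_sum_nonneg[OF f1 mult vals]) auto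
      qed simp
      finally show ?case .
    qed
    hence "(\<Sum>k<K. x ^ (2 ^ k)) \<le> - (\<Sum>n. f n * lambert_weight x n)"
      by (intro tendsto_lowerbound[OF Glim]) auto
    thus ?thesis using b by linarith
  qed
  obtain K :: nat where K: "real K > 4 * C + 1" using reals_Archimedean2 by blast
  have "C \<ge> 0" using bounded[of 0] by simp
  hence "K > 0" using K by (intro Nat.gr0I) auto
  \<comment> \<open>By Bernoulli's inequality this \<open>x\<close> keeps each of the
    \<open>K\<close> terms \<open>x ^ (2 ^ k)\<close> at least 1/2, so
    \<open>K / 2 \<le> 2 * C\<close>, against the choice of \<open>K\<close>.\<close>
  define x :: real where "x = 1 - 1 / 2 ^ K"
  have "(2::real) ^ 1 \<le> 2 ^ K" using \<open>K > 0\<close> by (intro power_increasing) auto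
  hence x: "0 < x" "x < 1" unfolding x_def by (simp_all add: field_simps)
  have "1 / 2 \<le> x ^ (2 ^ k)" if "k < K" for k
  proof -
    have "2 ^ Suc k \<le> (2::real) ^ K" using that by (intro power_increasing) auto
    hence "1 / 2 \<le> 1 + real (2 ^ k) * (- 1 / 2 ^ K)" by (simp add: field_simps)
    also have "\<dots> \<le> (1 + (- 1 / 2 ^ K)) ^ (2 ^ k)"
      by (rule Bernoulli_inequality) simp
    finally show ?thesis by (simp add: x_def)
  qed
  hence "(\<Sum>k<K. 1 / 2) \<le> (\<Sum>k<K. x ^ (2 ^ k))" by (intro sum_mono) auto
  hence "real K / 2 \<le> (\<Sum>k<K. x ^ (2 ^ k))" by simp
  thus False using bound[OF x, of K] K by linarith
qed

section \<open>Continuity of the series down to the point 1\<close>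

lemma powr_weight:
  assumes "s \<ge> (1::real)"
  shows "n \<ge> 1 \<Longrightarrow> real (Suc n) powr -s \<le> real n powr -s"
    and "(\<lambda>n. real n powr -s) \<longlonglongrightarrow> 0"
proof -
  show "n \<ge> 1 \<Longrightarrow> real (Suc n) powr -s \<le> real n powr -s"
    using assms by (intro powr_mono2') auto
  show "(\<lambda>n. real n powr -s) \<longlonglongrightarrow> 0"
    using assms by (intro tendsto_neg_powr filterlim_real_sequentially) auto
qed

definition L :: "real \<Rightarrow> real" where
  "L s = (\<Sum>n. f n * real n powr -s)"

text \<open>The estimate is free of \<open>s\<close>, so it gives both boundedness and uniform
  convergence on all of \<open>s \<ge> 1\<close>.\<close>

lemma L_tail:
  assumes "s \<ge> 1" "m \<ge> 1"
  shows "\<bar>L s - (\<Sum>n<m. f n * real n powr -s)\<bar> \<le> 2 * C / m"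
proof -
  have "C \<ge> 0" using bounded[of 0] by simp
  have "\<bar>L s - (\<Sum>n<m. f n * real n powr -s)\<bar> \<le> 2 * C * real m powr -s"
    unfolding L_def
    by (rule dirichlet_test(2)[OF bounded powr_weight(1)[OF assms(1)] _ powr_weight(2)[OF assms(1)] assms(2)]) auto
  also have "real m powr -s \<le> real m powr -1"
    using assms by (intro powr_mono) auto
  hence "2 * C * real m powr -s \<le> 2 * C * real m powr -1"
    using \<open>C \<ge> 0\<close> by (intro mult_left_mono) auto
  finally show ?thesis using assms(2) by (simp add: powr_minus_divide)
qed

lemma L_bounded: "s \<ge> 1 \<Longrightarrow> \<bar>L s\<bar> \<le> 2 * C"
  using L_tail[of s 1] by (simp add: f0)

text \<open>The uniform tail bound makes \<open>L\<close> a uniform limit of continuous functions up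
  to the endpoint 1, where absolute convergence may fail.\<close>

lemma L_tendsto: "(L \<longlongrightarrow> L 1) (at_right 1)"
proof -
  have unif: "uniform_limit {1..} (\<lambda>m s. \<Sum>n<m. f n * real n powr -s) L sequentially"
    unfolding uniform_limit_iff
  proof (intro allI impI)
    fix e :: real assume "e > 0"
    have "(\<lambda>m. 2 * C * (1 / real m)) \<longlonglongrightarrow> 2 * C * 0" by (intro tendsto_intros lim_1_over_n)
    hence "eventually (\<lambda>m. 2 * C * (1 / real m) < e) sequentially"
      using \<open>e > 0\<close> by (intro order_tendstoD(2)) auto
    thus "\<forall>\<^sub>F m in sequentially. \<forall>s\<in>{1..}. dist (\<Sum>n<m. f n * real n powr -s) (L s) < e"
      using eventually_ge_at_top[of 1]
    proof eventually_elim
      case (elim m)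
      show ?case
      proof
        fix s :: real assume "s \<in> {1..}"
        hence "\<bar>L s - (\<Sum>n<m. f n * real n powr -s)\<bar> \<le> 2 * C / m"
          using elim by (intro L_tail) auto
        thus "dist (\<Sum>n<m. f n * real n powr -s) (L s) < e"
          using elim by (simp add: dist_real_def abs_minus_commute)
      qed
    qed
  qed
  have cont: "\<forall>\<^sub>F m in sequentially. continuous_on {1..} (\<lambda>s. \<Sum>n<m. f n * real n powr -s)"
  proof (intro always_eventually allI continuous_on_sum continuous_on_mult continuous_on_const)
    fix n :: nat
    show "continuous_on {1..} (\<lambda>s. real n powr -s)"
      by (cases "n = 0") (auto intro!: continuous_intros)
  qed
  have "continuous_on {1..} L"
    by (rule uniform_limit_theorem[OF cont unif]) simp
  hence "(L \<longlongrightarrow> L 1) (at 1 within {1..})" by (simp add: continuous_on_def)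
  thus ?thesis by (rule tendsto_within_subset) auto
qed

lemma L_1_nonzero: "f 2 = 0 \<Longrightarrow> L 1 \<noteq> 0"
proof -
  have "f n * real n powr -1 = f n * (1 / real n)" for n
    by (cases "n = 0") (simp_all add: f0 powr_minus_divide)
  thus "f 2 = 0 \<Longrightarrow> L 1 \<noteq> 0" using sum_over_n_nonzero by (simp add: L_def)
qed

end

section \<open>Euler products\<close>

text \<open>Multiplying the series by \<open>1 - f q\<close> deletes the terms at multiples of
  \<open>q\<close>, by complete multiplicativity; the primes of \<open>P\<close> are sieved out one
  after another.\<close>

lemma sieve_identity:
  fixes f :: "nat \<Rightarrow> real"
  assumes mult: "\<And>m n. f (m * n) = f m * f n"
    and summ: "summable (\<lambda>n. \<bar>f n\<bar>)"
    and P: "finite P" "\<And>p. p \<in> P \<Longrightarrow> prime p"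
  defines "g \<equiv> \<lambda>P n. if \<exists>p\<in>P. p dvd n then 0 else f n"
  shows "(\<Prod>p\<in>P. 1 - f p) * (\<Sum>n. f n) = (\<Sum>n. g P n)"
  using P
proof (induction P rule: finite_induct)
  case empty
  thus ?case by (simp add: g_def)
next
  case (insert q P)
  have q: "prime q" and primeP: "\<And>p. p \<in> P \<Longrightarrow> prime p" using insert.prems by auto
  have summg: "summable (g Q)" for Q
    by (rule summable_comparison_test'[OF summ, of 0]) (auto simp: g_def)
  have shift: "f q * g P n = g P (q * n)" for n
  proof -
    have "p dvd q * n \<longleftrightarrow> p dvd n" if "p \<in> P" for p
    proof -
      have "p \<noteq> q" using that insert.hyps by auto
      hence "\<not> p dvd q" using primeP[OF that] q by (metis primes_dvd_imp_eq)
      thus ?thesis using primeP[OF that] by (auto simp: prime_dvd_mult_iff)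
    qed
    thus ?thesis by (auto simp: g_def mult)
  qed
  define h where "h = (\<lambda>n. if q dvd n then g P n else 0)"
  have "summable h"
    by (rule summable_comparison_test'[OF summ, of 0]) (auto simp: h_def g_def)
  have "f q * (\<Sum>n. g P n) = (\<Sum>n. g P (q * n))"
    unfolding shift[symmetric] by (rule suminf_mult[OF summg, symmetric])
  also have "\<dots> = (\<Sum>n. h (q * n))" by (simp add: h_def)
  also have "\<dots> = (\<Sum>n. h n)"
    using prime_gt_0_nat[OF q]
    by (intro suminf_mono_reindex) (auto simp: strict_mono_def h_def dvd_def)
  finally have "(1 - f q) * (\<Sum>n. g P n) = (\<Sum>n. g P n) - (\<Sum>n. h n)"
    by (simp add: algebra_simps)
  also have "\<dots> = (\<Sum>n. g P n - h n)" by (rule suminf_diff[OF summg \<open>summable h\<close>])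
  also have "\<dots> = (\<Sum>n. g (insert q P) n)"
    by (intro arg_cong[of _ _ suminf] ext) (auto simp: h_def g_def)
  finally have *: "(1 - f q) * (\<Sum>n. g P n) = (\<Sum>n. g (insert q P) n)" .
  have "(\<Prod>p\<in>insert q P. 1 - f p) * (\<Sum>n. f n) = (1 - f q) * ((\<Prod>p\<in>P. 1 - f p) * (\<Sum>n. f n))"
    using insert.hyps by simp
  also have "\<dots> = (1 - f q) * (\<Sum>n. g P n)" using insert.IH[OF primeP] by simp
  finally show ?case using * by simp
qed

text \<open>After sieving by the primes up to \<open>N\<close>, only the term 1 survives below
  \<open>N + 1\<close>, and the rest is bounded by a tail of the absolute series. Keeping the
  product on the side of the sum avoids inverses.\<close>

theorem euler_product:
  fixes f :: "nat \<Rightarrow> real"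
  assumes f0: "f 0 = 0" and f1: "f 1 = 1" and mult: "\<And>m n. f (m * n) = f m * f n"
    and summ: "summable (\<lambda>n. \<bar>f n\<bar>)"
  shows "(\<lambda>N. (\<Prod>p | prime p \<and> p \<le> N. 1 - f p) * (\<Sum>n. f n)) \<longlonglongrightarrow> 1"
proof -
  define g where "g = (\<lambda>N n. if \<exists>p\<in>{p. prime p \<and> p \<le> N}. p dvd n then 0 else f n)"
  have eq: "(\<Prod>p | prime p \<and> p \<le> N. 1 - f p) * (\<Sum>n. f n) = (\<Sum>n. g N n)" for N
    unfolding g_def by (rule sieve_identity[OF mult summ]) (auto intro: finite_subset[of _ "{..N}"])
  have bound: "\<bar>(\<Sum>n. g N n) - 1\<bar> \<le> (\<Sum>n. \<bar>f n\<bar>) - (\<Sum>n<Suc N. \<bar>f n\<bar>)" if "N \<ge> 1" for N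
  proof -
    have summg: "summable (g N)"
      by (rule summable_comparison_test'[OF summ, of 0]) (auto simp: g_def)
    have small: "g N n = (if n = 1 then 1 else 0)" if "n < Suc N" for n
    proof (cases "n \<le> 1")
      case True
      hence "n = 0 \<or> n = 1" by auto
      thus ?thesis using f0 f1 by (auto simp: g_def)
    next
      case False
      then obtain p where p: "prime p" "p dvd n" using prime_factor_nat[of n] by auto
      have "p \<le> N" using dvd_imp_le[OF p(2)] that False by simp
      thus ?thesis using p False by (auto simp: g_def)
    qed
    have "(\<Sum>n<Suc N. g N n) = (\<Sum>n<Suc N. if n = 1 then 1 else 0)"
      by (intro sum.cong refl) (use small in auto)
    also have "\<dots> = 1" using that by (simp add: sum.delta)
    finally have "(\<Sum>n. g N n) - 1 = (\<Sum>n. g N (n + Suc N))"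
      using suminf_split_initial_segment[OF summg, of "Suc N"] by simp
    also have "\<bar>\<dots>\<bar> \<le> (\<Sum>n. \<bar>g N (n + Suc N)\<bar>)"
      by (rule summable_rabs, rule summable_comparison_test'[OF summable_ignore_initial_segment[OF summ, of "Suc N"], of 0])
         (auto simp: g_def)
    also have "\<dots> \<le> (\<Sum>n. \<bar>f (n + Suc N)\<bar>)"
      by (intro suminf_le summable_ignore_initial_segment summ
          summable_comparison_test'[OF summable_ignore_initial_segment[OF summ, of "Suc N"], of 0])
         (auto simp: g_def)
    also have "\<dots> = (\<Sum>n. \<bar>f n\<bar>) - (\<Sum>n<Suc N. \<bar>f n\<bar>)"
      using suminf_minus_initial_segment[OF summ, of "Suc N"] by simp
    finally show ?thesis .
  qed
  have "(\<lambda>N. (\<Sum>n. \<bar>f n\<bar>) - (\<Sum>n<Suc N. \<bar>f n\<bar>)) \<longlonglongrightarrow> (\<Sum>n. \<bar>f n\<bar>) - (\<Sum>n. \<bar>f n\<bar>)"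
    by (intro tendsto_intros LIMSEQ_Suc summable_LIMSEQ summ)
  hence "(\<lambda>N. (\<Sum>n. g N n) - 1) \<longlonglongrightarrow> 0"
    by (intro Lim_null_comparison[of "\<lambda>N. (\<Sum>n. g N n) - 1" "\<lambda>N. (\<Sum>n. \<bar>f n\<bar>) - (\<Sum>n<Suc N. \<bar>f n\<bar>)"])
       (use bound in \<open>auto intro: eventually_sequentiallyI[of 1]\<close>)
  thus ?thesis unfolding eq by (simp add: LIM_zero_iff)
qed

theorem euler_product_comparison:
  fixes f :: "'i \<Rightarrow> nat \<Rightarrow> real"
  assumes "finite A" "finite B"
    and f0: "\<And>S. S \<in> A \<union> B \<Longrightarrow> f S 0 = 0" and f1: "\<And>S. S \<in> A \<union> B \<Longrightarrow> f S 1 = 1"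
    and mult: "\<And>S m n. S \<in> A \<union> B \<Longrightarrow> f S (m * n) = f S m * f S n"
    and summ: "\<And>S. S \<in> A \<union> B \<Longrightarrow> summable (\<lambda>n. \<bar>f S n\<bar>)"
    and prime: "\<And>p. prime p \<Longrightarrow> (\<Prod>S\<in>A. 1 - f S p) = (\<Prod>S\<in>B. 1 - f S p)"
  shows "(\<Prod>S\<in>A. \<Sum>n. f S n) = (\<Prod>S\<in>B. \<Sum>n. f S n)"
proof -
  define R where "R = (\<lambda>A N. \<Prod>S\<in>A. \<Prod>p | prime p \<and> p \<le> N. 1 - f S p)"
  have lim: "(\<lambda>N. R X N * (\<Prod>S\<in>X. \<Sum>n. f S n)) \<longlonglongrightarrow> 1" if "X \<subseteq> A \<union> B" for X
  proof -
    have "(\<lambda>N. \<Prod>S\<in>X. (\<Prod>p | prime p \<and> p \<le> N. 1 - f S p) * (\<Sum>n. f S n)) \<longlonglongrightarrow> (\<Prod>S\<in>X. 1)"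
      using that by (intro tendsto_prod euler_product f0 f1 mult summ) auto
    thus ?thesis by (simp add: R_def prod.distrib)
  qed
  have "R A N = R B N" for N
  proof -
    have "R A N = (\<Prod>p | prime p \<and> p \<le> N. \<Prod>S\<in>A. 1 - f S p)"
      unfolding R_def by (rule prod.swap)
    also have "\<dots> = (\<Prod>p | prime p \<and> p \<le> N. \<Prod>S\<in>B. 1 - f S p)"
      by (intro prod.cong refl prime) auto
    also have "\<dots> = R B N" unfolding R_def by (rule prod.swap)
    finally show ?thesis .
  qed
  hence R: "R A = R B" by (rule ext)
  define X Y where "X = (\<Prod>S\<in>A. \<Sum>n. f S n)" and "Y = (\<Prod>S\<in>B. \<Sum>n. f S n)"
  \<comment> \<open>The same sequence tends to \<open>Y\<close> because \<open>R * X\<close> tends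
    to 1, and to \<open>X\<close> because \<open>R * Y\<close> does.\<close>
  have "(\<lambda>N. R B N * X * Y) \<longlonglongrightarrow> 1 * Y"
    using lim[of A] unfolding R X_def by (intro tendsto_mult_right) auto
  moreover have "(\<lambda>N. R B N * Y * X) \<longlonglongrightarrow> 1 * X"
    using lim[of B] unfolding Y_def by (intro tendsto_mult_right) auto
  hence "(\<lambda>N. R B N * X * Y) \<longlonglongrightarrow> 1 * X" by (simp add: mult_ac)
  ultimately have "1 * Y = 1 * X" by (rule LIMSEQ_unique)
  thus ?thesis by (simp add: X_def Y_def)
qed

section \<open>Primes modulo which given integers are nonresidues\<close>

text \<open>Defined outside \<open>real_character\<close> because square \<open>D\<close> is needed
  too, where the coefficients have unbounded partial sums.\<close>

definition qL :: "int \<Rightarrow> nat \<Rightarrow> real \<Rightarrow> real" where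
  "qL D M s = (\<Sum>n. qchar D M n * real n powr -s)"

lemma qL_summable:
  assumes "s > 1"
  shows "summable (\<lambda>n. \<bar>qchar D M n * real n powr -s\<bar>)"
proof (rule summable_comparison_test'[of "\<lambda>n. real n powr -s" 0])
  show "summable (\<lambda>n. real n powr -s)" using assms by (subst summable_real_powr_iff) simp
  show "norm \<bar>qchar D M n * real n powr -s\<bar> \<le> real n powr -s" for n
    using qchar_values[of D M n] by (auto simp: abs_mult)
qed

lemma real_character_qchar:
  assumes "D \<noteq> 0" "\<not> is_square D" "M > 0" "even M" "D dvd int M"
  obtains C where "real_character (qchar D M) C"
proof -
  obtain C where C: "\<And>N. \<bar>\<Sum>n<N. qchar D M n\<bar> \<le> C"
    using qchar_partial_sums_bounded[OF assms] by blast
  have "real_character (qchar D M) C"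
    by unfold_locales (use assms C qchar_mult qchar_values in auto)
  thus ?thesis by (rule that)
qed

lemma qL_nonsquare_bounded:
  assumes "D \<noteq> 0" "\<not> is_square D" "M > 0" "even M" "D dvd int M"
  obtains K where "\<And>s. s \<ge> 1 \<Longrightarrow> \<bar>qL D M s\<bar> \<le> K"
proof -
  obtain C where "real_character (qchar D M) C" using real_character_qchar[OF assms] .
  then interpret real_character "qchar D M" C .
  show ?thesis using that[of "2 * C"] L_bounded by (simp add: L_def qL_def)
qed

lemma qchar_square:
  assumes "D \<noteq> 0" "is_square D" "even M" "D dvd int M"
  shows "qchar D M n = (if coprime n M then 1 else 0)"
proof -
  obtain s where s: "D = s ^ 2" using assms(2) by (auto elim: is_nth_powerE)
  have "Jacobi D n = 1" if "coprime n M"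
    unfolding s using coprime_even_odd[OF that assms(3)] coprime_dvd_int[OF that assms(4)] s
    by (intro Jacobi_square) auto
  thus ?thesis by (simp add: qchar_def)
qed

lemma qL_square_ge:
  assumes "D \<noteq> 0" "is_square D" "M > 0" "even M" "D dvd int M" "s > 1"
  shows "(\<Sum>n<N. qchar D M n * real n powr -s) \<le> qL D M s"
proof -
  have "summable (\<lambda>n. qchar D M n * real n powr -s)"
    using summable_rabs_cancel[OF qL_summable[OF assms(6)]] .
  thus ?thesis unfolding qL_def
    by (intro sum_le_suminf) (use qchar_square[OF assms(1,2,4,5)] in auto)
qed

lemma qL_bounded_below:
  assumes "D \<noteq> 0" "M > 0" "even M" "D dvd int M"
  obtains \<delta> where "\<delta> > 0" "eventually (\<lambda>s. \<bar>qL D M s\<bar> \<ge> \<delta>) (at_right 1)"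
proof (cases "is_square D")
  case True
  have "eventually (\<lambda>s. \<bar>qL D M s\<bar> \<ge> 1) (at_right 1)"
    using eventually_at_right_less[of "1::real"]
  proof eventually_elim
    case (elim s)
    \<comment> \<open>The term at 0 vanishes and the term at 1 is 1; for square \<open>D\<close> the
      remaining terms are nonnegative.\<close>
    have "1 = (\<Sum>n<2. qchar D M n * real n powr -s)"
      using assms by (simp add: numeral_2_eq_2)
    thus ?case using qL_square_ge[OF assms(1) True assms(2-4) elim, of 2] by linarith
  qed
  thus ?thesis using that[of 1] by simp
next
  case False
  obtain C where "real_character (qchar D M) C"
    using real_character_qchar[OF assms(1) False assms(2-4)] .
  then interpret real_character "qchar D M" C .
  have "L 1 \<noteq> 0" using L_1_nonzero assms by simp
  have "((\<lambda>s. \<bar>L s\<bar>) \<longlongrightarrow> \<bar>L 1\<bar>) (at_right 1)" by (intro tendsto_rabs L_tendsto)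
  hence "eventually (\<lambda>s. \<bar>L 1\<bar> / 2 < \<bar>L s\<bar>) (at_right 1)"
    by (rule order_tendstoD(1)) (use \<open>L 1 \<noteq> 0\<close> in simp)
  hence "eventually (\<lambda>s. \<bar>L 1\<bar> / 2 \<le> \<bar>qL D M s\<bar>) (at_right 1)"
    by eventually_elim (simp add: L_def qL_def)
  thus ?thesis using that[of "\<bar>L 1\<bar> / 2"] \<open>L 1 \<noteq> 0\<close> by simp
qed

text \<open>The numbers \<open>1 + k * M\<close> are prime to \<open>M\<close> and their reciprocals
  have a divergent sum. Some finite partial sum thus exceeds \<open>B\<close> at
  \<open>s = 1\<close>, and by continuity also near 1.\<close>

lemma qL_one_unbounded:
  assumes "M > 0" "even M"
  shows "eventually (\<lambda>s. qL 1 M s > B) (at_right 1)"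
proof -
  have ch: "qchar 1 M n = (if coprime n M then 1 else 0)" for n
    using assms by (intro qchar_square) auto
  have "\<not> summable (\<lambda>n. qchar 1 M n * real n powr -1)"
  proof
    assume *: "summable (\<lambda>n. qchar 1 M n * real n powr -1)"
    have "summable (\<lambda>k. qchar 1 M (1 + k * M) * real (1 + k * M) powr -1)"
      by (rule summable_reindex[OF *, of "\<lambda>k. 1 + k * M", unfolded o_def])
         (use assms ch in \<open>auto simp: inj_on_def\<close>)
    moreover have "qchar 1 M (1 + k * M) * real (1 + k * M) powr -1 = inverse (1 + real k * real M)" for k
    proof -
      have "gcd M (k * M + 1) = gcd M 1" by (rule gcd_add_mult)
      also have "\<dots> = 1" by simp
      finally have "coprime (1 + k * M) M"
        by (simp only: coprime_iff_gcd_eq_1 gcd.commute[of _ M] add.commute[of 1])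
      thus ?thesis by (simp add: ch powr_minus)
    qed
    ultimately have s: "summable (\<lambda>k. real M * inverse (1 + real k * real M))"
      by (simp only:) (rule summable_mult)
    have "summable (\<lambda>k. inverse (real (Suc k)))"
    proof (rule summable_comparison_test'[OF s, of 0])
      fix k
      have le: "1 + real k * real M \<le> real M * real (Suc k)" using assms(1) by (simp add: algebra_simps)
      have pos: "1 + real k * real M > 0" by (simp add: add_pos_nonneg)
      have "inverse (real (Suc k)) = real M * inverse (real M * real (Suc k))"
        using assms(1) by (simp del: of_nat_Suc)
      also have "\<dots> \<le> real M * inverse (1 + real k * real M)"
        by (intro mult_left_mono le_imp_inverse_le le pos) simp
      finally show "norm (inverse (real (Suc k))) \<le> real M * inverse (1 + real k * real M)"
        by (simp del: of_nat_Suc)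
    qed
    thus False using not_summable_harmonic[where 'a = real] summable_Suc_iff[of "\<lambda>k. inverse (real k)"] by simp
  qed
  hence "\<not> (\<exists>b. \<forall>N. (\<Sum>n<N. qchar 1 M n * real n powr -1) \<le> b)"
    using summableI_nonneg_bounded[of "\<lambda>n. qchar 1 M n * real n powr -1"] ch by auto
  then obtain N where N: "(\<Sum>n<N. qchar 1 M n * real n powr -1) > B" using not_le by blast
  have "((\<lambda>s. \<Sum>n<N. qchar 1 M n * real n powr -s) \<longlongrightarrow> (\<Sum>n<N. qchar 1 M n * real n powr -1)) (at_right 1)"
  proof (intro tendsto_sum tendsto_mult tendsto_const)
    fix n :: nat
    show "((\<lambda>s. real n powr - s) \<longlongrightarrow> real n powr - 1) (at_right 1)"
      by (cases "n = 0", simp, intro tendsto_powr tendsto_const tendsto_minus tendsto_ident_at) simp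
  qed
  hence "eventually (\<lambda>s. (\<Sum>n<N. qchar 1 M n * real n powr -s) > B) (at_right 1)"
    using N by (rule order_tendstoD(1))
  thus ?thesis using eventually_at_right_less[of "1::real"]
  proof eventually_elim
    case (elim s)
    have "(\<Sum>n<N. qchar 1 M n * real n powr -s) \<le> qL 1 M s"
      using assms elim by (intro qL_square_ge) auto
    thus ?case using elim by simp
  qed
qed

text \<open>Adding or removing \<open>i\<close> is an involution on the subsets of \<open>I\<close>
  that reverses the parity of the cardinality and preserves \<open>\<phi>\<close>.\<close>

lemma prod_toggle:
  fixes i :: 'a and \<phi> :: "'a set \<Rightarrow> 'b::comm_monoid_mult"
  assumes "finite I" "i \<in> I" "\<And>S. S \<subseteq> I \<Longrightarrow> i \<notin> S \<Longrightarrow> \<phi> (insert i S) = \<phi> S"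
  shows "(\<Prod>S | S \<subseteq> I \<and> even (card S). \<phi> S) = (\<Prod>S | S \<subseteq> I \<and> odd (card S). \<phi> S)"
proof -
  define t where "t = (\<lambda>S. if i \<in> S then S - {i} else insert i S)"
  have tt: "t (t S) = S" for S by (auto simp: t_def)
  have sub: "t S \<subseteq> I" if "S \<subseteq> I" for S using that assms(2) by (auto simp: t_def)
  have card: "even (card (t S)) \<longleftrightarrow> odd (card S)" if "S \<subseteq> I" for S
  proof -
    have fin: "finite S" using that assms(1) finite_subset by blast
    show ?thesis
    proof (cases "i \<in> S")
      case True
      hence "card S = Suc (card (S - {i}))" using fin by (metis card_Suc_Diff1)
      thus ?thesis using True by (simp add: t_def)
    qed (use fin in \<open>simp add: t_def\<close>)
  qed
  have val: "\<phi> (t S) = \<phi> S" if "S \<subseteq> I" for S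
  proof (cases "i \<in> S")
    case True
    have "S - {i} \<subseteq> I" using that by auto
    thus ?thesis using assms(3)[of "S - {i}"] True by (simp add: t_def insert_absorb)
  qed (use assms(3)[of S] that in \<open>simp add: t_def\<close>)
  show ?thesis
    by (rule prod.reindex_bij_witness[of _ t t]) (auto simp: tt card val dest: sub)
qed

theorem prime_with_all_nonresidues:
  fixes a :: "'i \<Rightarrow> int"
  assumes "finite I" and nz: "\<And>i. i \<in> I \<Longrightarrow> a i \<noteq> 0"
    and nonsq: "\<And>T. T \<subseteq> I \<Longrightarrow> odd (card T) \<Longrightarrow> \<not> is_square (\<Prod>j\<in>T. a j)"
  obtains p :: nat where "prime p" "2 < p" "\<And>i. i \<in> I \<Longrightarrow> Legendre (a i) p = -1"
proof (rule ccontr)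
  note obt = that
  assume "\<not> thesis"
  hence no: "\<exists>i\<in>I. Legendre (a i) (int p) \<noteq> -1" if "prime p" "2 < p" for p :: nat
    using that obt by blast
  \<comment> \<open>The factor 2 makes every number prime to \<open>M\<close> odd, and each subset
    product divides \<open>M\<close>, so one modulus serves all the characters.\<close>
  define M where "M = 2 * nat \<bar>\<Prod>i\<in>I. a i\<bar>"
  have nzI: "(\<Prod>i\<in>I. a i) \<noteq> 0" using nz assms(1) by simp
  have M: "M > 0" "even M" using nzI by (simp_all add: M_def)
  have intM: "int M = 2 * \<bar>\<Prod>i\<in>I. a i\<bar>" by (simp add: M_def)
  define b where "b = (\<lambda>S. \<Prod>j\<in>S. a j)"
  have b_nz: "b S \<noteq> 0" if "S \<subseteq> I" for S
    using that nz assms(1) by (auto simp: b_def finite_subset)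
  have b_dvd: "b S dvd int M" if "S \<subseteq> I" for S
    using prod_dvd_prod_subset[OF assms(1) that, of a] unfolding intM b_def by (simp add: dvd_mult)
  define A B where "A = {S. S \<subseteq> I \<and> even (card S)}" and "B = {S. S \<subseteq> I \<and> odd (card S)}"
  have fin: "finite A" "finite B" using assms(1) by (simp_all add: A_def B_def)
  have sub: "S \<subseteq> I" if "S \<in> A \<union> B" for S using that by (auto simp: A_def B_def)
  have eq: "(\<Prod>S\<in>A. qL (b S) M s) = (\<Prod>S\<in>B. qL (b S) M s)" if "s > 1" for s
    unfolding qL_def
  proof (rule euler_product_comparison)
    show "(\<Prod>S\<in>A. 1 - qchar (b S) M p * real p powr -s) = (\<Prod>S\<in>B. 1 - qchar (b S) M p * real p powr -s)"
      if p: "prime p" for p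
    proof (cases "coprime p M")
      case False
      thus ?thesis by (simp add: qchar_def)
    next
      case True
      have "odd p" by (rule coprime_even_odd[OF True M(2)])
      hence "2 < p" using p prime_ge_2_nat[of p] by (cases "p = 2") auto
      then obtain i where i: "i \<in> I" "Legendre (a i) (int p) \<noteq> -1" using no p by blast
      have cop: "coprime (int p) (a i)"
        using coprime_dvd_int[OF True b_dvd[of "{i}"]] i(1) by (simp add: b_def)
      have "\<not> int p dvd a i"
      proof
        assume "int p dvd a i"
        hence "is_unit (int p)" using cop by (meson coprime_common_divisor dvd_refl)
        thus False using prime_gt_1_nat[OF p] by simp
      qed
      \<comment> \<open>The symbol is nonzero since \<open>p\<close> is prime to \<open>a i\<close>,
        and it is not -1 by the choice of \<open>i\<close>; multiplying by \<open>a i\<close>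
        therefore leaves the Euler factor at \<open>p\<close> unchanged.\<close>
      hence one: "Jacobi (a i) p = 1"
        using i(2) p by (auto simp: Jacobi_prime Legendre_def cong_0_iff split: if_splits)
      show ?thesis unfolding A_def B_def
      proof (rule prod_toggle[OF assms(1) i(1)])
        fix S assume S: "S \<subseteq> I" "i \<notin> S"
        have "b (insert i S) = a i * b S"
          using S assms(1) by (simp add: b_def finite_subset)
        thus "1 - qchar (b (insert i S)) M p * real p powr -s = 1 - qchar (b S) M p * real p powr -s"
          by (simp add: qchar_def Jacobi_mult_left[OF \<open>odd p\<close>] one)
      qed
    qed
  qed (use M fin that qL_summable[of s] in \<open>simp_all add: qchar_mult powr_mult\<close>)
  have "\<exists>K. \<forall>s\<ge>1. \<bar>qL (b S) M s\<bar> \<le> K" if "S \<in> B" for S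
  proof -
    have "\<not> is_square (b S)" using that nonsq by (auto simp: B_def b_def)
    thus ?thesis using qL_nonsquare_bounded[OF b_nz _ M b_dvd, of S] sub[of S] that by blast
  qed
  then obtain K where K: "\<And>S s. S \<in> B \<Longrightarrow> s \<ge> 1 \<Longrightarrow> \<bar>qL (b S) M s\<bar> \<le> K S" by metis
  have "\<exists>\<delta>>0. eventually (\<lambda>s. \<bar>qL (b S) M s\<bar> \<ge> \<delta>) (at_right 1)" if "S \<in> A" for S
    using qL_bounded_below[OF b_nz M b_dvd, of S] sub[of S] that by blast
  then obtain \<delta> where \<delta>: "\<And>S. S \<in> A \<Longrightarrow> \<delta> S > 0"
    "\<And>S. S \<in> A \<Longrightarrow> eventually (\<lambda>s. \<bar>qL (b S) M s\<bar> \<ge> \<delta> S) (at_right 1)" by metis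
  have emp: "{} \<in> A" by (simp add: A_def)
  \<comment> \<open>\<open>d\<close> bounds from below the even factors other than that of the empty
    set, and \<open>k\<close> bounds the odd product from above; a value of \<open>qL 1 M s\<close>
    above \<open>k / d\<close> is then contradictory.\<close>
  define d where "d = (\<Prod>S\<in>A - {{}}. \<delta> S)"
  define k where "k = (\<Prod>S\<in>B. K S)"
  have "d > 0" unfolding d_def using \<delta>(1) by (intro prod_pos) auto
  have "eventually (\<lambda>s. \<forall>S\<in>A. \<bar>qL (b S) M s\<bar> \<ge> \<delta> S) (at_right 1)"
    using \<delta>(2) by (intro eventually_ball_finite fin) auto
  moreover have "eventually (\<lambda>s. qL 1 M s > k / d) (at_right 1)"
    by (rule qL_one_unbounded[OF M])
  moreover have "eventually (\<lambda>s. s > 1) (at_right (1::real))" by (rule eventually_at_right_less)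
  ultimately have "eventually (\<lambda>s. False) (at_right (1::real))"
  proof eventually_elim
    case (elim s)
    have "k < qL 1 M s * d" using elim(2) \<open>d > 0\<close> by (simp add: field_simps)
    also have "\<dots> \<le> \<bar>qL (b {}) M s\<bar> * (\<Prod>S\<in>A - {{}}. \<bar>qL (b S) M s\<bar>)"
      unfolding d_def b_def using elim(1) \<delta>(1)
      by (intro mult_mono prod_mono prod_nonneg) (auto simp: less_imp_le b_def)
    also have "\<dots> = \<bar>\<Prod>S\<in>A. qL (b S) M s\<bar>"
      using prod.remove[OF fin(1) emp, of "\<lambda>S. \<bar>qL (b S) M s\<bar>"] by (simp add: abs_prod)
    also have "\<dots> = (\<Prod>S\<in>B. \<bar>qL (b S) M s\<bar>)" by (simp add: eq[OF elim(3)] abs_prod)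
    also have "\<dots> \<le> k" unfolding k_def using elim(3) K by (intro prod_mono) auto
    finally show False by simp
  qed
  thus False by simp
qed

section \<open>Roots modulo prime powers\<close>

text \<open>Pigeonhole on multiplicities: if each were at most \<open>e\<close>, their sum could not
  reach \<open>e * card I + 1\<close>.\<close>

lemma prime_power_dvd_prodE:
  fixes f :: "'i \<Rightarrow> int"
  assumes "finite I" "prime q" "q ^ Suc (e * card I) dvd (\<Prod>i\<in>I. f i)"
  obtains i where "i \<in> I" "q ^ e dvd f i"
proof (rule ccontr)
  note obt = that
  assume "\<not> thesis"
  hence no: "\<not> q ^ e dvd f i" if "i \<in> I" for i using obt that by blast
  hence nz: "f i \<noteq> 0" if "i \<in> I" for i using that by fastforce
  have m: "multiplicity q (f i) \<le> e" if "i \<in> I" for i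
    using no[OF that] nz[OF that] multiplicity_dvd'[of e q "f i"] by (metis nat_le_linear)
  have "Suc (e * card I) \<le> multiplicity q (\<Prod>i\<in>I. f i)"
    using assms nz by (intro multiplicity_geI) (auto simp: prime_elem_not_unit)
  also have "\<dots> = (\<Sum>i\<in>I. multiplicity q (f i))"
    using assms nz by (intro prime_elem_multiplicity_prod_distrib) auto
  also have "\<dots> \<le> (\<Sum>i\<in>I. e)" by (intro sum_mono m)
  finally show False by simp
qed

text \<open>Hensel lifting: the derivative \<open>2 * x\<close> is invertible modulo
  \<open>p\<close>.\<close>

lemma sqrt_mod_odd_prime_power:
  fixes a p :: int
  assumes "prime p" "odd p" "\<not> p dvd a" "QuadRes p a"
  shows "\<exists>x. p ^ k dvd x\<^sup>2 - a"
proof (induction k)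
  case (Suc k)
  then obtain x0 where x0: "p ^ k dvd x0\<^sup>2 - a" by blast
  \<comment> \<open>At least one factor \<open>p\<close> is needed to conclude that \<open>p\<close>
    does not divide \<open>x\<close>; for \<open>k = 0\<close> it comes from
    \<open>QuadRes p a\<close>.\<close>
  obtain x where x: "p ^ max k 1 dvd x\<^sup>2 - a"
  proof (cases k)
    case 0
    thus ?thesis using assms(4) that unfolding QuadRes_def by (auto simp: cong_iff_dvd_diff)
  qed (use x0 that in simp)
  define l where "l = max k 1"
  have pl: "p dvd p ^ l" using le_imp_power_dvd[of 1 l p] by (simp add: l_def)
  hence "p dvd x\<^sup>2 - a" using x dvd_trans unfolding l_def by blast
  have "\<not> p dvd x"
  proof
    assume "p dvd x"
    hence "p dvd x\<^sup>2" by (simp add: power2_eq_square)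
    hence "p dvd x\<^sup>2 - (x\<^sup>2 - a)" using \<open>p dvd x\<^sup>2 - a\<close> by (rule dvd_diff)
    thus False using assms(3) by simp
  qed
  moreover have "\<not> p dvd 2"
    using assms(1,2) primes_dvd_imp_eq[of p 2] by auto
  ultimately have "coprime (2 * x) p"
    using assms(1) by (metis coprime_commute prime_dvd_mult_iff prime_imp_coprime)
  then obtain u where u: "[2 * x * u = 1] (mod p)" using cong_solve_coprime_int by blast
  from x obtain c where c: "x\<^sup>2 - a = p ^ l * c" unfolding l_def by (auto simp: dvd_def)
  \<comment> \<open>Chosen to solve \<open>c + 2 * x * t = 0\<close> modulo \<open>p\<close>, the
    linear condition for replacing \<open>x\<close> by \<open>x + p ^ l * t\<close>.\<close>
  define t where "t = - c * u"
  have "p dvd 2 * x * u - 1" using u by (simp add: cong_iff_dvd_diff)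
  hence "p dvd - c * (2 * x * u - 1)" by (rule dvd_mult)
  hence 1: "p dvd c + 2 * x * t" by (simp add: t_def algebra_simps)
  have "p dvd p ^ l * t\<^sup>2" using pl by (rule dvd_mult2)
  hence "p dvd c + 2 * x * t + p ^ l * t\<^sup>2" using 1 by simp
  hence "p ^ l * p dvd p ^ l * (c + 2 * x * t + p ^ l * t\<^sup>2)" by (rule mult_dvd_mono[OF dvd_refl])
  also have "p ^ l * (c + 2 * x * t + p ^ l * t\<^sup>2) = (x\<^sup>2 - a) + p ^ l * (2 * x * t) + (p ^ l * t)\<^sup>2"
    unfolding c by (simp add: power2_eq_square algebra_simps)
  also have "\<dots> = (x + p ^ l * t)\<^sup>2 - a" by (simp add: power2_eq_square algebra_simps)
  finally have "p ^ Suc l dvd (x + p ^ l * t)\<^sup>2 - a" by (simp add: mult.commute)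
  moreover have "p ^ Suc k dvd p ^ Suc l" by (intro le_imp_power_dvd) (simp add: l_def)
  ultimately show ?case using dvd_trans by blast
qed simp

text \<open>The derivative \<open>2 * x\<close> vanishes modulo 2, so lifting starts from the root 1
  modulo 8 and keeps \<open>x\<close> odd. Adding \<open>2 ^ (k + 2) * c\<close> replaces the error
  factor \<open>c\<close> by \<open>(1 + x) * c\<close> up to an even number, and
  \<open>1 + x\<close> is even.\<close>

lemma sqrt_mod_two_power:
  fixes m :: int
  shows "\<exists>x. 2 ^ k dvd x\<^sup>2 - (8 * m + 1)"
proof -
  define a where "a = 8 * m + 1"
  have "\<exists>x. odd x \<and> 2 ^ (k + 3) dvd x\<^sup>2 - a"
  proof (induction k)
    case 0
    show ?case by (rule exI[of _ 1]) (simp add: a_def)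
  next
    case (Suc k)
    then obtain x c where x: "odd x" and c: "x\<^sup>2 - a = 2 ^ (k + 3) * c" by (auto simp: dvd_def)
    define y where "y = x + 2 ^ (k + 2) * c"
    have "odd y" using x by (simp add: y_def)
    obtain d where d: "1 + x = 2 * d" using x by (metis evenE even_plus_one_iff add.commute)
    have "y\<^sup>2 - a = (x\<^sup>2 - a) + 2 ^ (k + 3) * (x * c) + 2 ^ (k + 4) * (2 ^ k * c\<^sup>2)"
      by (simp add: y_def power2_eq_square algebra_simps power_add)
    also have "\<dots> = 2 ^ (k + 3) * ((1 + x) * c) + 2 ^ (k + 4) * (2 ^ k * c\<^sup>2)"
      unfolding c by (simp add: algebra_simps)
    also have "\<dots> = 2 ^ (k + 4) * (d * c + 2 ^ k * c\<^sup>2)"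
      unfolding d by (simp add: algebra_simps power_add)
    finally have "2 ^ (Suc k + 3) dvd y\<^sup>2 - a" by (simp add: add.commute)
    thus ?case using \<open>odd y\<close> by blast
  qed
  moreover have "(2::int) ^ k dvd 2 ^ (k + 3)" by (simp add: le_imp_power_dvd)
  ultimately show ?thesis unfolding a_def using dvd_trans by blast
qed

lemma cong_poly_int:
  fixes f :: "int poly"
  assumes "[x = y] (mod m)"
  shows "[poly f x = poly f y] (mod m)"
  by (induction f) (auto intro!: cong_add cong_mult assms)

text \<open>The full power of one prime is split off and the two roots are glued by the Chinese
  remainder theorem.\<close>

lemma root_mod_from_prime_powers:
  fixes f :: "int poly"
  assumes "\<And>p k. prime p \<Longrightarrow> \<exists>x. p ^ k dvd poly f x" and "m > 0"
  shows "\<exists>x. int m dvd poly f x"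
  using assms(2)
proof (induction m rule: less_induct)
  case (less m)
  show ?case
  proof (cases "m = 1")
    case False
    then obtain p where p: "prime p" "p dvd m" using prime_factor_nat by blast
    obtain l k where mk: "m = p ^ k * l" "\<not> p dvd l"
      using prime_power_canonical[OF p(1) less.prems] by (metis mult.commute)
    have "k > 0" using p mk by (cases k) auto
    hence "1 < p ^ k" using prime_gt_1_nat[OF p(1)] by (intro one_less_power)
    moreover have "l > 0" using less.prems mk by (auto intro: Nat.gr0I)
    ultimately have "l < m" using mk by simp
    then obtain y where y: "int l dvd poly f y" using less.IH \<open>l > 0\<close> by blast
    obtain x where x: "int p ^ k dvd poly f x" using assms(1)[of "int p" k] p(1) by auto
    have cop: "coprime (int p ^ k) (int l)"
      using p(1) mk(2) prime_imp_coprime[of p l] by simp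
    then obtain z where z: "[z = x] (mod int p ^ k)" "[z = y] (mod int l)"
      using binary_chinese_remainder_int by blast
    have "int p ^ k dvd poly f z" using cong_dvd_iff[OF cong_poly_int[OF z(1), of f]] x
      by (metis cong_poly_int cong_0_iff cong_trans z(1))
    moreover have "int l dvd poly f z" using y
      by (metis cong_poly_int cong_0_iff cong_trans z(2))
    ultimately show ?thesis using divides_mult[OF _ _ cop] mk(1) by auto
  qed simp
qed

text \<open>An even \<open>a\<close> would make \<open>x\<close> even and so be divisible by 4,
  against squarefreeness; odd squares are 1 modulo 8.\<close>

lemma square_mod_8:
  fixes a x :: int
  assumes "squarefree a" "8 dvd x\<^sup>2 - a"
  shows "a mod 8 = 1"
proof -
  obtain c where c: "x\<^sup>2 - a = 8 * c" using assms(2) by (auto simp: dvd_def)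
  hence xc: "x\<^sup>2 = 8 * c + a" by simp
  have "odd a"
  proof
    assume "even a"
    hence "even (x\<^sup>2)" using xc by simp
    then obtain y where y: "x = 2 * y" by (auto elim: evenE)
    have "a = 2\<^sup>2 * (y\<^sup>2 - 2 * c)" using c unfolding y by (simp add: power2_eq_square)
    hence "2\<^sup>2 dvd a" by (rule dvdI)
    hence "(2::int) dvd 1" using assms(1) squarefreeD by blast
    thus False by simp
  qed
  hence "odd (x\<^sup>2)" using xc by simp
  then obtain y where y: "x = 2 * y + 1" by (auto elim: oddE)
  have "even (y * (y + 1))" by simp
  then obtain d where "y * (y + 1) = 2 * d" by (rule evenE)
  hence "x\<^sup>2 = 8 * d + 1" unfolding y by (simp add: power2_eq_square algebra_simps)
  hence "a = 1 + 8 * (d - c)" using c by simp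
  thus ?thesis by (simp only: mod_mult_self2) simp
qed

lemma Legendre_prod:
  fixes p :: nat
  assumes "prime p" "2 < p"
  shows "Legendre (\<Prod>j\<in>T. a j) p = (\<Prod>j\<in>T. Legendre (a j) p)"
  by (induction T rule: infinite_finite_induct)
     (use assms Legendre_mult[OF assms] Legendre_one[of p] in auto)

text \<open>If every symbol were -1, an odd number of them would multiply to -1, which is impossible
  for a square.\<close>

lemma residue_of_odd_square_product:
  fixes p :: nat and a :: "'i \<Rightarrow> int"
  assumes "prime p" "2 < p" "odd (card T)" "is_square (\<Prod>j\<in>T. a j)"
    and "\<And>j. j \<in> T \<Longrightarrow> \<not> int p dvd a j"
  obtains j where "j \<in> T" "Legendre (a j) p = 1"
proof (rule ccontr)
  note obt = that
  assume "\<not> thesis"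
  have "Legendre (a j) p = -1" if "j \<in> T" for j
  proof -
    have "Legendre (a j) p \<noteq> 1" using obt that \<open>\<not> thesis\<close> by blast
    thus ?thesis using assms(5)[OF that] by (simp add: Legendre_def cong_0_iff split: if_splits)
  qed
  hence "Legendre (\<Prod>j\<in>T. a j) p = (\<Prod>j\<in>T. -1)"
    unfolding Legendre_prod[OF assms(1,2)] by (intro prod.cong) auto
  hence neg: "Legendre (\<Prod>j\<in>T. a j) p = -1" using assms(3) by simp
  obtain s where s: "(\<Prod>j\<in>T. a j) = s\<^sup>2" using assms(4) by (auto elim: is_nth_powerE)
  have "QuadRes p (s\<^sup>2)" unfolding QuadRes_def using cong_refl by blast
  thus False using neg unfolding s by (simp add: Legendre_def split: if_splits)
qed

section \<open>Solvability modulo every integer and the two conditions\<close>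

theorem theorem1:
  fixes n :: nat and a :: "nat \<Rightarrow> int"
  assumes "n \<ge> 3"
    and "inj_on a {1..n}"
    and "\<And>i. i \<in> {1..n} \<Longrightarrow> a i \<noteq> 0"
    and "\<And>i. i \<in> {1..n} \<Longrightarrow> squarefree (a i)"
    and "\<And>i. i \<in> {1..n} \<Longrightarrow> a i \<noteq> 1"
  shows "has_roots_modulo_every_pos_int (\<Prod>i=1..n. [:- a i, 0, 1:]) \<longleftrightarrow>
    (\<exists>T. T \<subseteq> {1..n} \<and> odd (card T) \<and>
        is_square (\<Prod>j\<in>T. a j) \<and>
        (\<forall>j\<in>T. \<forall>p::int. prime p \<longrightarrow> odd p \<longrightarrow> p dvd a j \<longrightarrow>
           (\<exists>i\<in>{1..n}. i \<noteq> j \<and> Legendre (a i) p = 1))) \<and>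
    (\<exists>i\<in>{1..n}. \<exists>m::int. m \<noteq> 0 \<and> a i = 8 * m + 1)"
  (is "has_roots_modulo_every_pos_int ?f \<longleftrightarrow> (\<exists>T. ?P T) \<and> ?Q")
proof
  have poly_f: "poly ?f x = (\<Prod>i=1..n. x\<^sup>2 - a i)" for x
    by (simp add: poly_prod power2_eq_square)
  {
    assume "has_roots_modulo_every_pos_int ?f"
    hence root: "\<exists>x. m dvd poly ?f x" if "m > 0" for m :: int
      using that by (auto simp: has_roots_modulo_every_pos_int_def cong_0_iff)
    \<comment> \<open>A root modulo a sufficiently high power of \<open>q\<close> forces a
      prescribed power of \<open>q\<close> into a single factor.\<close>
    have factor: "\<exists>x. \<exists>i\<in>{1..n}. q ^ e dvd x\<^sup>2 - a i" if "prime q" for q :: int and e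
    proof -
      have "q ^ Suc (e * card {1..n}) > 0" using prime_gt_0_int[OF that] by simp
      then obtain x where "q ^ Suc (e * card {1..n}) dvd (\<Prod>i=1..n. x\<^sup>2 - a i)"
        using root unfolding poly_f by blast
      thus ?thesis using prime_power_dvd_prodE[OF _ that] by blast
    qed
    \<comment> \<open>Condition (b) holds for every odd \<open>T\<close> with square product, so
      only the existence of such a \<open>T\<close> remains for the analytic argument.\<close>
    have "?P T" if T: "T \<subseteq> {1..n}" "odd (card T)" "is_square (\<Prod>j\<in>T. a j)" for T
    proof (intro conjI ballI allI impI T)
      fix j :: nat and q :: int
      assume j: "j \<in> T" and q: "prime q" "odd q" "q dvd a j"
      \<comment> \<open>The square of \<open>q\<close> is used so that \<open>q dvd a i\<close>
        would give \<open>q\<^sup>2 dvd a i\<close>, contradicting squarefreeness.\<close>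
      obtain x i where xi: "i \<in> {1..n}" "q\<^sup>2 dvd x\<^sup>2 - a i" using factor[OF q(1)] by blast
      have "q dvd x\<^sup>2 - a i" using dvd_trans[OF _ xi(2), of q] by (simp add: power2_eq_square)
      have "\<not> q dvd a i"
      proof
        assume "q dvd a i"
        hence "q dvd (x\<^sup>2 - a i) + a i" by (rule dvd_add[OF \<open>q dvd x\<^sup>2 - a i\<close>])
        hence "q dvd x\<^sup>2" by simp
        hence "q dvd x" using q(1) prime_dvd_power by blast
        hence "q\<^sup>2 dvd x\<^sup>2" by (rule dvd_power_same)
        hence "q\<^sup>2 dvd x\<^sup>2 - (x\<^sup>2 - a i)" using xi(2) by (rule dvd_diff)
        hence "q\<^sup>2 dvd a i" by simp
        hence "q dvd 1" using assms(4)[OF xi(1)] squarefreeD by blast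
        thus False using q(1) by (simp add: not_prime_unit)
      qed
      moreover have "QuadRes q (a i)"
        using \<open>q dvd x\<^sup>2 - a i\<close> unfolding QuadRes_def by (auto simp: cong_iff_dvd_diff)
      ultimately have "Legendre (a i) q = 1" by (simp add: Legendre_def cong_0_iff)
      moreover have "i \<noteq> j" using \<open>\<not> q dvd a i\<close> q(3) by auto
      ultimately show "\<exists>i\<in>{1..n}. i \<noteq> j \<and> Legendre (a i) q = 1" using xi(1) by blast
    qed
    moreover have "\<exists>T. T \<subseteq> {1..n} \<and> odd (card T) \<and> is_square (\<Prod>j\<in>T. a j)"
    proof (rule ccontr)
      assume "\<not> ?thesis"
      hence nonsq: "\<not> is_square (\<Prod>j\<in>T. a j)" if "T \<subseteq> {1..n}" "odd (card T)" for T
        using that by blast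
      show False
      proof (rule prime_with_all_nonresidues[OF finite_atLeastAtMost assms(3) nonsq])
        fix p :: nat
        assume p: "prime p" "\<And>i. i \<in> {1..n} \<Longrightarrow> Legendre (a i) p = -1"
        have "prime (int p)" using p(1) by simp
        then obtain x i where xi: "i \<in> {1..n}" "int p ^ 1 dvd x\<^sup>2 - a i" using factor by blast
        hence "QuadRes (int p) (a i)" unfolding QuadRes_def by (auto simp: cong_iff_dvd_diff)
        thus False using p(2)[OF xi(1)] by (simp add: Legendre_def split: if_splits)
      qed
    qed
    ultimately have "\<exists>T. ?P T" by blast
    moreover have ?Q
    proof -
      obtain x i where xi: "i \<in> {1..n}" "2 ^ 3 dvd x\<^sup>2 - a i" using factor[of 2 3] by auto
      hence "a i mod 8 = 1" using square_mod_8[OF assms(4)[OF xi(1)]] by simp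
      then obtain m where m: "a i = 8 * m + 1"
        using mult_div_mod_eq[of 8 "a i"] by (metis add.commute)
      have "m \<noteq> 0" using m assms(5)[OF xi(1)] by auto
      thus ?Q using m xi(1) by blast
    qed
    ultimately show "(\<exists>T. ?P T) \<and> ?Q" ..
  }
  {
    assume "(\<exists>T. ?P T) \<and> ?Q"
    then obtain T i0 m0 where T: "T \<subseteq> {1..n}" "odd (card T)" "is_square (\<Prod>j\<in>T. a j)"
      and ram: "\<And>j p. j \<in> T \<Longrightarrow> prime p \<Longrightarrow> odd p \<Longrightarrow> p dvd a j \<Longrightarrow> \<exists>i\<in>{1..n}. i \<noteq> j \<and> Legendre (a i) p = 1"
      and i0: "i0 \<in> {1..n}" "a i0 = 8 * m0 + 1" by blast
    have dvd_f: "q dvd poly ?f x" if "i \<in> {1..n}" "q dvd x\<^sup>2 - a i" for q x i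
      unfolding poly_f using that dvd_prodI[of "{1..n}" i "\<lambda>i. x\<^sup>2 - a i"] dvd_trans by blast
    have pp: "\<exists>x. p ^ k dvd poly ?f x" if p: "prime p" for p :: int and k
    proof (cases "p = 2")
      case True
      obtain x where "2 ^ k dvd x\<^sup>2 - a i0" using sqrt_mod_two_power[of k m0] i0(2) by auto
      thus ?thesis using dvd_f[OF i0(1)] True by blast
    next
      case False
      hence "odd p" using p primes_dvd_imp_eq[of 2 p] by auto
      define q where "q = nat p"
      have q: "prime q" "p = int q" using p prime_ge_0_int[of p] by (auto simp: q_def prime_nat_iff_prime)
      have "2 < q" using False q prime_ge_2_nat[of q] by (cases "q = 2") auto
      \<comment> \<open>If \<open>p\<close> divides some \<open>a j\<close> with
        \<open>j \<in> T\<close>, condition (b) provides the residue; otherwise the parity of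
        \<open>card T\<close> does.\<close>
      have "\<exists>i\<in>{1..n}. Legendre (a i) p = 1"
      proof (cases "\<exists>j\<in>T. p dvd a j")
        case True
        thus ?thesis using ram p \<open>odd p\<close> by blast
      next
        case False
        then obtain j where "j \<in> T" "Legendre (a j) (int q) = 1"
          using residue_of_odd_square_product[OF q(1) \<open>2 < q\<close> T(2,3)] q(2) by blast
        thus ?thesis using T(1) q(2) by blast
      qed
      then obtain i where i: "i \<in> {1..n}" "Legendre (a i) p = 1" by blast
      hence "\<not> p dvd a i" "QuadRes p (a i)" by (auto simp: Legendre_def cong_0_iff split: if_splits)
      thus ?thesis using sqrt_mod_odd_prime_power[OF p \<open>odd p\<close>] dvd_f[OF i(1)] by blast
    qed
    show "has_roots_modulo_every_pos_int ?f"
      unfolding has_roots_modulo_every_pos_int_def cong_0_iff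
    proof (intro allI impI)
      fix m :: int assume "m > 0"
      thus "\<exists>x. m dvd poly ?f x"
        using root_mod_from_prime_powers[OF pp, of "nat m"] by simp
    qed
  }
qed

end
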